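(* Let $(G_n)_{n\ge1}$ be a sequence of abelian groups and, for each $n$, let $Y_n\subseteq G_n$ be a subset with $|Y_n|=n$. Let $m=m(n)$ and $s=s(n)$ be positive integers such that $2s\le m$ for all $n$ and $m=o\!\left(\frac{s^2}{(\log n)^2}\right)$ as $n\to\infty$. Then there exist sequences $\varepsilon_n\to0$ and $\eta_n\to0$ such that, for all $n$, the number of subsets $A\subseteq Y_n$ with $|A|=s$ and $|A+A|\le m$ is at most \[2^{\varepsilon_n s}\binom{\frac{m+\beta}{2}}{s},\qquad\text{where } \beta=\beta_{G_n}\big((1+\eta_n)m\big).\]
   Context: For an abelian group $G$ and a real number $x>0$, $\beta_G(x)$ denotes the largest size of a subgroup $H\le G$ with $|H|\le x$. For $A\subseteq G$, $A+A=\{a_1+a_2:a_1,a_2\in A\}$. For real $x$ and integer $s\ge0$, $\binom{x}{s}=x(x-1)\cdots(x-s+1)/s!$ if $x\ge s$ and $\binom{x}{s}=0$ if $x<s$. Logarithms are base $2$. *)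

theory Defs
  imports
    Complex_Main
    "HOL-Algebra.Coset"
    "HOL-Library.Landau_Symbols"
begin

text \<open>
  Abelian groups are multiplicative (\<^locale>\<open>comm_group\<close>), so the sumset \<open>A + A\<close> is
  \<open>A <#>\<^bsub>G\<^esub> A\<close>. The set below contains 1 (from the trivial subgroup) whenever \<open>x \<ge> 1\<close>
  and is empty for \<open>x < 1\<close>, where the value is unspecified.
\<close>

definition subgroup_beta :: "('a, 'b) monoid_scheme \<Rightarrow> real \<Rightarrow> nat" where
  "subgroup_beta G x = Max {card H | H. subgroup H G \<and> finite H \<and> real (card H) \<le> x}"

definition trunc_binomial :: "real \<Rightarrow> nat \<Rightarrow> real" where
  "trunc_binomial x s = (if x \<ge> real s then x gchoose s else 0)"

end

theory Submission imports Defs begin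

text \<open>
  Let \<open>|A + A| \<le> m\<close>. Fix any \<open>T \<subseteq> A\<close> with about \<open>\<surd>m\<close> elements and greedily enlarge \<open>T' \<subseteq> A\<close> as
  long as some \<open>v \<in> A\<close> has more than \<open>\<kappa>|T|\<close> sums \<open>v + a\<close>, \<open>a \<in> T\<close>, outside \<open>S = T + T'\<close>. Since
  \<open>S \<subseteq> A + A\<close>, this stops with \<open>|T'| \<le> \<surd>m / \<kappa>\<close>, and then \<open>A\<close> lies in the set \<open>Z\<close> of all \<open>v\<close> with
  few sums outside \<open>S\<close>; double counting gives \<open>|Z| \<le> 2m\<close>. If at least \<open>\<surd>m\<close> elements of \<open>A\<close> are
  heavy, i.e. have a positive proportion of their sums with \<open>Z\<close> outside \<open>S\<close>, repeat with \<open>T\<close> made of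
  heavy elements: \<open>|Z| - |S|\<close> drops by a constant fraction of \<open>m\<close>, so boundedly many rounds suffice.
  At the end all but \<open>\<surd>m\<close> elements of \<open>A\<close> lie in the set of light elements of \<open>Z\<close>, which has at most
  \<open>(1 + \<gamma>)(m + \<beta>)/2\<close> elements by a Pollard-type inequality for abelian groups. The fingerprints
  have \<open>O(\<surd>m) = o(s / log n)\<close> elements in total and hence cost only a factor \<open>2\<^bsup>o(s)\<^esup>\<close>.
\<close>

section \<open>A Pollard-type inequality in abelian groups\<close>

context comm_group
begin

section \<open>Truncated representation counts and the Dyson transform\<close>

definition rep :: "'a set \<Rightarrow> 'a set \<Rightarrow> 'a \<Rightarrow> nat" where
  "rep A B x = card {p \<in> A \<times> B. fst p \<otimes> snd p = x}"

text \<open>The quantity in Pollard's theorem. Unlike the size of \<open>A <#> B\<close> it is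
  robust: discarding some pairs lowers it by at most their number, which
  \<open>card_light_le\<close> exploits.\<close>

definition pollard_sum :: "nat \<Rightarrow> 'a set \<Rightarrow> 'a set \<Rightarrow> nat" where
  "pollard_sum t A B = (\<Sum>x\<in>A <#> B. min t (rep A B x))"

lemma finite_set_mult [simp]: "finite A \<Longrightarrow> finite B \<Longrightarrow> finite (A <#> B)"
  by (simp add: set_mult_def)

lemma rep_Un_left:
  assumes "finite A" "finite A'" "finite B" "A \<inter> A' = {}"
  shows "rep (A \<union> A') B x = rep A B x + rep A' B x"
proof -
  have "{p \<in> (A \<union> A') \<times> B. fst p \<otimes> snd p = x}
      = {p \<in> A \<times> B. fst p \<otimes> snd p = x} \<union> {p \<in> A' \<times> B. fst p \<otimes> snd p = x}"
    by auto
  with assms show ?thesis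
    unfolding rep_def by (auto intro!: card_Un_disjoint)
qed

lemma rep_commute:
  assumes "A \<subseteq> carrier G" "B \<subseteq> carrier G"
  shows "rep A B x = rep B A x"
  unfolding rep_def using assms
  by (intro bij_betw_same_card[of prod.swap] bij_betw_byWitness[where f' = prod.swap])
     (auto simp: subset_iff m_comm)

lemma rep_eq_0: "x \<notin> A <#> B \<Longrightarrow> rep A B x = 0"
  by (auto simp: rep_def set_mult_def card_eq_0_iff)

lemma pollard_sum_superset:
  assumes "finite X" "A <#> B \<subseteq> X"
  shows "pollard_sum t A B = (\<Sum>x\<in>X. min t (rep A B x))"
  unfolding pollard_sum_def using assms by (intro sum.mono_neutral_left) (auto simp: rep_eq_0)

lemma rep_translate:
  assumes "A \<subseteq> carrier G" "B \<subseteq> carrier G" "g \<in> carrier G" "x \<in> carrier G"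
  shows "rep A ((\<lambda>b. b \<otimes> g) ` B) (x \<otimes> g) = rep A B x"
proof -
  have "{p \<in> A \<times> (\<lambda>b. b \<otimes> g) ` B. fst p \<otimes> snd p = x \<otimes> g}
      = map_prod id (\<lambda>b. b \<otimes> g) ` {p \<in> A \<times> B. fst p \<otimes> snd p = x}"
    using assms by (force simp: m_assoc[symmetric] subset_iff)
  moreover have "inj_on (map_prod id (\<lambda>b. b \<otimes> g)) {p \<in> A \<times> B. fst p \<otimes> snd p = x}"
    using assms by (auto simp: inj_on_def subset_iff)
  ultimately show ?thesis
    by (simp add: rep_def card_image)
qed

text \<open>Lets the induction in \<open>pollard_sum_ge\<close> shift \<open>B\<close> into a useful
  position relative to \<open>A\<close>; translation only relabels the sums.\<close>

lemma pollard_sum_translate: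
  assumes "A \<subseteq> carrier G" "B \<subseteq> carrier G" "g \<in> carrier G"
  shows "pollard_sum t A ((\<lambda>b. b \<otimes> g) ` B) = pollard_sum t A B"
proof -
  have AB: "A <#> B \<subseteq> carrier G"
    using assms by (simp add: set_mult_closed)
  have "A <#> (\<lambda>b. b \<otimes> g) ` B = (\<lambda>x. x \<otimes> g) ` (A <#> B)"
    using assms by (force simp: set_mult_def m_assoc subset_iff)
  moreover have "inj_on (\<lambda>x. x \<otimes> g) (A <#> B)"
    using AB assms by (auto simp: inj_on_def subset_iff)
  ultimately show ?thesis
    unfolding pollard_sum_def using AB assms
    by (auto simp: sum.reindex rep_translate intro!: sum.cong)
qed

text \<open>Writing \<open>A = I + A\<^sub>0\<close> and \<open>B = I + B\<^sub>0\<close> for the intersection \<open>I\<close>, the product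
  \<open>(I + A\<^sub>0)(I + B\<^sub>0)\<close> of indicator functions is \<open>(I + A\<^sub>0 + B\<^sub>0) I + A\<^sub>0 B\<^sub>0\<close>.\<close>

lemma rep_Un_Int:
  assumes "A \<subseteq> carrier G" "B \<subseteq> carrier G" "finite A" "finite B"
  shows "rep A B x = rep (A \<union> B) (A \<inter> B) x + rep (A - B) (B - A) x"
proof -
  define I where "I = A \<inter> B"
  define A0 where "A0 = A - B"
  define B0 where "B0 = B - A"
  have eqs: "A = I \<union> A0" "B = I \<union> B0" "A \<union> B = A \<union> B0"
    and disj: "I \<inter> A0 = {}" "I \<inter> B0 = {}" "A \<inter> B0 = {}"
    and fin: "finite I" "finite A0" "finite B0"
    and sub: "I \<subseteq> carrier G" "A0 \<subseteq> carrier G" "B0 \<subseteq> carrier G"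
    using assms by (auto simp: I_def A0_def B0_def)
  have "rep A B x = rep B A x"
    using assms by (simp add: rep_commute)
  also have "\<dots> = rep I A x + rep B0 A x"
    unfolding eqs(2) using disj fin assms by (simp add: rep_Un_left)
  also have "rep I A x = rep A I x"
    using assms sub by (simp add: rep_commute)
  also have "rep B0 A x = rep A B0 x"
    using assms sub by (simp add: rep_commute)
  also have "rep A B0 x = rep I B0 x + rep A0 B0 x"
    by (subst eqs(1)) (use disj fin assms in \<open>simp add: rep_Un_left\<close>)
  also have "rep I B0 x = rep B0 I x"
    using assms sub by (simp add: rep_commute)
  also have "rep A I x + (rep B0 I x + rep A0 B0 x) = rep (A \<union> B) I x + rep A0 B0 x"
    unfolding eqs(3) using disj fin assms by (simp add: rep_Un_left)
  finally show ?thesis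
    by (simp add: I_def A0_def B0_def)
qed

lemma sum_rep:
  assumes "finite A" "finite B" "finite X"
  shows "(\<Sum>x\<in>X. rep A B x) = card {p \<in> A \<times> B. fst p \<otimes> snd p \<in> X}"
proof -
  have "{p \<in> A \<times> B. fst p \<otimes> snd p \<in> X} = (\<Union>x\<in>X. {p \<in> A \<times> B. fst p \<otimes> snd p = x})"
    by auto
  also have "card \<dots> = (\<Sum>x\<in>X. card {p \<in> A \<times> B. fst p \<otimes> snd p = x})"
    using assms by (intro card_UN_disjoint) auto
  finally show ?thesis
    by (simp add: rep_def)
qed

lemma rep_le_card_right:
  assumes "A \<subseteq> carrier G" "B \<subseteq> carrier G" "finite B"
  shows "rep A B x \<le> card B"
  unfolding rep_def
proof (rule card_inj_on_le)
  show "inj_on snd {p \<in> A \<times> B. fst p \<otimes> snd p = x}"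
    using assms by (auto simp: inj_on_def subset_iff)
qed (use assms in auto)

text \<open>No element has more than \<open>card B\<close> representations, so truncation at this
  level has no effect and every pair is counted.\<close>

lemma pollard_sum_card_right:
  assumes "A \<subseteq> carrier G" "B \<subseteq> carrier G" "finite A" "finite B"
  shows "pollard_sum (card B) A B = card A * card B"
proof -
  have "pollard_sum (card B) A B = (\<Sum>x\<in>A <#> B. rep A B x)"
    unfolding pollard_sum_def using assms by (simp add: min_absorb2 rep_le_card_right)
  also have "\<dots> = card {p \<in> A \<times> B. fst p \<otimes> snd p \<in> A <#> B}"
    using assms by (simp add: sum_rep)
  also have "{p \<in> A \<times> B. fst p \<otimes> snd p \<in> A <#> B} = A \<times> B"
    unfolding set_mult_def by force
  finally show ?thesis
    by (simp add: card_cartesian_product)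
qed

text \<open>The Dyson transform for truncated counts: by \<open>rep_Un_Int\<close> the two
  representation functions add up to that of \<open>A\<close> and \<open>B\<close>, and min i p +
  min j q is at most min (i + j) (p + q).\<close>

lemma pollard_sum_Un_Int_le:
  assumes "A \<subseteq> carrier G" "B \<subseteq> carrier G" "finite A" "finite B"
  shows "pollard_sum i (A \<union> B) (A \<inter> B) + pollard_sum j (A - B) (B - A) \<le> pollard_sum (i + j) A B"
proof -
  have "(A \<union> B) <#> (A \<inter> B) \<subseteq> A <#> B"
  proof
    fix x assume "x \<in> (A \<union> B) <#> (A \<inter> B)"
    then obtain u v where uv: "u \<in> A \<union> B" "v \<in> A" "v \<in> B" "x = u \<otimes> v"
      by (auto simp: set_mult_def)
    then have "x = v \<otimes> u"
      using assms by (auto intro: m_comm)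
    then show "x \<in> A <#> B"
      using uv unfolding set_mult_def by blast
  qed
  moreover have "(A - B) <#> (B - A) \<subseteq> A <#> B"
    by (auto simp: set_mult_def)
  ultimately have "pollard_sum i (A \<union> B) (A \<inter> B) + pollard_sum j (A - B) (B - A)
    = (\<Sum>x\<in>A <#> B. min i (rep (A \<union> B) (A \<inter> B) x) + min j (rep (A - B) (B - A) x))"
    using assms by (simp add: pollard_sum_superset[where X = "A <#> B"] sum.distrib)
  also have "\<dots> \<le> pollard_sum (i + j) A B"
    unfolding pollard_sum_def using rep_Un_Int[OF assms] by (intro sum_mono) auto
  finally show ?thesis .
qed

text \<open>The case where the Dyson transform is stuck. Differences of \<open>B\<close> stabilise
  \<open>A\<close>, so \<open>B\<close> lies in a coset of the stabiliser \<open>H\<close>, and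
  every element of \<open>A <#> B\<close> has at least \<open>t\<close> representations; the sum is
  thus at least \<open>t * card A\<close>. If \<open>card H\<close> is at most \<open>M\<close>,
  then \<open>card B \<le> card H \<le> \<beta>\<close>; otherwise \<open>M\<close> is below
  \<open>card H \<le> card A\<close>.\<close>

lemma pollard_sum_ge_if_stable:
  assumes "A \<subseteq> carrier G" "B \<subseteq> carrier G" "finite A" "finite B" "A \<noteq> {}" "B \<noteq> {}" "t \<le> card B"
    and stable: "\<And>a b b'. a \<in> A \<Longrightarrow> b \<in> B \<Longrightarrow> b' \<in> B \<Longrightarrow> b \<otimes> inv b' \<otimes> a \<in> A"
    and beta: "\<And>H. subgroup H G \<Longrightarrow> finite H \<Longrightarrow> real (card H) \<le> M \<Longrightarrow> card H \<le> \<beta>"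
  shows "real t * min M (real (card A) + real (card B) - real t - real \<beta>) \<le> real (pollard_sum t A B)"
proof -
  obtain a0 b0 where a0: "a0 \<in> A" and b0: "b0 \<in> B"
    using assms by auto
  define H where "H = {h \<in> carrier G. h <# A = A}"
  have H: "subgroup H G"
  proof
    show "x \<otimes> y \<in> H" if "x \<in> H" "y \<in> H" for x y
      using that assms(1) by (auto simp: H_def lcos_m_assoc[symmetric])
    show "inv x \<in> H" if "x \<in> H" for x
    proof -
      have x: "x \<in> carrier G" "x <# A = A"
        using that by (auto simp: H_def)
      then have "inv x <# (x <# A) = A"
        using assms(1) by (subst lcos_m_assoc) (auto simp: lcos_mult_one)
      then show ?thesis
        using x by (simp add: H_def)
    qed
  qed (use assms(1) in \<open>auto simp: H_def lcos_mult_one\<close>)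
  have inj: "inj_on (\<lambda>h. h \<otimes> a0) H"
    using a0 assms(1) by (auto simp: inj_on_def H_def subset_iff)
  have im: "(\<lambda>h. h \<otimes> a0) ` H \<subseteq> A"
    using a0 by (auto simp: H_def l_coset_def)
  have finH: "finite H"
    using finite_imageD[OF finite_subset[OF im] inj] assms by simp
  have HA: "card H \<le> card A"
    using card_inj_on_le[OF inj im] assms by simp
  have BH: "card B \<le> card H"
  proof (rule card_inj_on_le)
    show "inj_on (\<lambda>b. b \<otimes> inv b0) B"
      using b0 assms(2) by (auto simp: inj_on_def subset_iff)
    show "(\<lambda>b. b \<otimes> inv b0) ` B \<subseteq> H"
    proof clarify
      fix b assume b: "b \<in> B"
      \<comment> \<open>A translate contained in the finite set \<open>A\<close> has the same size
        as \<open>A\<close>, hence equals it.\<close>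
      have "(b \<otimes> inv b0) <# A \<subseteq> A"
        using stable b b0 by (auto simp: l_coset_def)
      moreover have "card ((b \<otimes> inv b0) <# A) = card A"
      proof -
        have "(b \<otimes> inv b0) <# A = (\<lambda>a. b \<otimes> inv b0 \<otimes> a) ` A"
          by (auto simp: l_coset_def)
        moreover have "inj_on (\<lambda>a. b \<otimes> inv b0 \<otimes> a) A"
          using b b0 assms(1,2) by (auto simp: inj_on_def subset_iff)
        ultimately show ?thesis
          by (simp add: card_image)
      qed
      moreover have "b \<otimes> inv b0 \<in> carrier G"
        using b b0 assms(2) by (simp add: subset_iff)
      ultimately show "b \<otimes> inv b0 \<in> H"
        using assms(3) card_subset_eq[of A] by (simp add: H_def)
    qed
  qed (rule finH)
  have "card A \<le> card (A <#> B)"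
  proof (rule card_inj_on_le)
    show "inj_on (\<lambda>a. a \<otimes> b0) A"
      using b0 assms(1,2) by (auto simp: inj_on_def subset_iff)
  qed (use b0 assms in \<open>auto simp: set_mult_def\<close>)
  moreover have "t \<le> rep A B x" if x: "x \<in> A <#> B" for x
  proof -
    obtain a b where ab: "a \<in> A" "b \<in> B" "x = a \<otimes> b"
      using x by (auto simp: set_mult_def)
    \<comment> \<open>The sum a + b is also (b - b' + a) + b' for each b' in \<open>B\<close>, and
      stability puts the first summand in \<open>A\<close>.\<close>
    have "(\<lambda>b'. (b \<otimes> inv b' \<otimes> a, b')) ` B \<subseteq> {p \<in> A \<times> B. fst p \<otimes> snd p = x}"
    proof clarify
      fix b' assume b': "b' \<in> B"
      have c: "a \<in> carrier G" "b \<in> carrier G" "b' \<in> carrier G"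
        using ab b' assms by auto
      have "b \<otimes> inv b' \<otimes> a = a \<otimes> b \<otimes> inv b'"
        using c by (simp add: m_ac)
      then have "b \<otimes> inv b' \<otimes> a \<otimes> b' = a \<otimes> b"
        using c by (simp add: m_assoc)
      then show "(b \<otimes> inv b' \<otimes> a, b') \<in> A \<times> B \<and> fst (b \<otimes> inv b' \<otimes> a, b') \<otimes> snd (b \<otimes> inv b' \<otimes> a, b') = x"
        using stable ab b' by simp
    qed
    moreover have "inj_on (\<lambda>b'. (b \<otimes> inv b' \<otimes> a, b')) B"
      by (auto simp: inj_on_def)
    ultimately have "card B \<le> rep A B x"
      unfolding rep_def using assms(3,4) by (intro card_inj_on_le) auto
    with assms show ?thesis by simp
  qed
  then have "pollard_sum t A B = t * card (A <#> B)"
    unfolding pollard_sum_def by (simp add: min_absorb1)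
  ultimately have "t * card A \<le> pollard_sum t A B"
    by simp
  then have "real t * real (card A) \<le> real (pollard_sum t A B)"
    by (metis of_nat_mono of_nat_mult)
  moreover have "min M (real (card A) + real (card B) - real t - real \<beta>) \<le> real (card A)"
  proof (cases "real (card H) \<le> M")
    case True
    then show ?thesis
      using beta[OF H finH] BH by simp
  next
    case False
    then show ?thesis
      using HA by simp
  qed
  ultimately show ?thesis
    by (meson mult_left_mono of_nat_0_le_iff order_trans)
qed

text \<open>Induction on \<open>card B\<close> by Dyson transforms of \<open>A\<close> with a
  translate of \<open>B\<close>. The minimum with \<open>M\<close> reflects that
  \<open>\<beta>\<close> only controls subgroups with at most \<open>M\<close> elements.\<close>

theorem pollard_sum_ge:
  assumes "A \<subseteq> carrier G" "B \<subseteq> carrier G" "finite A" "finite B" "1 \<le> t" "t \<le> card A" "t \<le> card B"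
    and beta: "\<And>H. subgroup H G \<Longrightarrow> finite H \<Longrightarrow> real (card H) \<le> M \<Longrightarrow> card H \<le> \<beta>"
  shows "real t * min M (real (card A) + real (card B) - real t - real \<beta>) \<le> real (pollard_sum t A B)"
  using assms(1-7)
proof (induction "card B" arbitrary: A B t rule: less_induct)
  case less
  show ?case
  proof (cases "\<exists>g\<in>carrier G. A \<inter> (\<lambda>b. b \<otimes> g) ` B \<noteq> {} \<and> \<not> (\<lambda>b. b \<otimes> g) ` B \<subseteq> A")
    case False
    \<comment> \<open>No transform makes progress, so each translate of \<open>B\<close> meeting
      \<open>A\<close> lies inside \<open>A\<close>. This is applied to the translate moving
      \<open>b'\<close> to \<open>a\<close>.\<close>
    have "b \<otimes> inv b' \<otimes> a \<in> A" if "a \<in> A" "b \<in> B" "b' \<in> B" for a b b'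
    proof -
      define g where "g = inv b' \<otimes> a"
      have c: "a \<in> carrier G" "b \<in> carrier G" "b' \<in> carrier G"
        using that less.prems by auto
      have "b' \<otimes> g = a"
        using c by (simp add: g_def m_assoc[symmetric])
      then have "a \<in> A \<inter> (\<lambda>b. b \<otimes> g) ` B"
        using that by auto
      moreover have "g \<in> carrier G"
        using c by (simp add: g_def)
      ultimately have "b \<otimes> g \<in> A"
        using False that by blast
      then show ?thesis
        using c by (simp add: g_def m_assoc)
    qed
    moreover have "A \<noteq> {}" "B \<noteq> {}"
      using less.prems by auto
    ultimately show ?thesis
      using less.prems beta by (intro pollard_sum_ge_if_stable) auto
  next
    case True
    then obtain g where g: "g \<in> carrier G"
      and ne: "A \<inter> (\<lambda>b. b \<otimes> g) ` B \<noteq> {}" "\<not> (\<lambda>b. b \<otimes> g) ` B \<subseteq> A"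
      by blast
    define B' where "B' = (\<lambda>b. b \<otimes> g) ` B"
    have inj: "inj_on (\<lambda>b. b \<otimes> g) B"
      using g less.prems(2) by (auto simp: inj_on_def subset_iff)
    have B': "B' \<subseteq> carrier G" "finite B'" "card B' = card B"
      using g less.prems inj by (auto simp: B'_def card_image)
    define i where "i = card (A \<inter> B')"
    have i: "0 < i" "i < card B"
    proof -
      show "0 < i"
        using ne less.prems by (auto simp: i_def B'_def card_gt_0_iff)
      have "A \<inter> B' \<subset> B'"
        using ne by (auto simp: B'_def)
      then show "i < card B"
        using psubset_card_mono[of B' "A \<inter> B'"] B' by (simp add: i_def)
    qed
    have cU: "card (A \<union> B') + i = card A + card B"
      using card_Un_Int[of A B'] B' less.prems by (simp add: i_def)
    have cA: "card (A - B') + i = card A"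
      using card_Int_Diff[of A B'] less.prems by (simp add: i_def)
    have cB: "card (B' - A) + i = card B"
      using card_Int_Diff[of B' A] B' by (simp add: i_def Int_commute)
    have eq: "pollard_sum t A B = pollard_sum t A B'"
      using g less.prems by (simp add: B'_def pollard_sum_translate)
    show ?thesis
    proof (cases "t \<le> i")
      case True
      \<comment> \<open>Union and intersection alone suffice: the total size is preserved and the
        second set has shrunk.\<close>
      have "real t * min M (real (card (A \<union> B')) + real (card (A \<inter> B')) - real t - real \<beta>)
          \<le> real (pollard_sum t (A \<union> B') (A \<inter> B'))"
        using less.prems B' True i cU by (intro less.hyps) (auto simp: i_def[symmetric])
      moreover have "pollard_sum t (A \<union> B') (A \<inter> B') \<le> pollard_sum t A B'"
        using pollard_sum_Un_Int_le[of A B' t 0] less.prems B' by simp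
      moreover have "real (card (A \<union> B')) + real (card (A \<inter> B')) = real (card A) + real (card B)"
        using cU by (simp add: i_def)
      ultimately show ?thesis
        by (simp add: eq)
    next
      case False
      let ?\<sigma> = "real (card A) + real (card B)"
      let ?\<mu> = "min M (?\<sigma> - real t - real \<beta>)"
      \<comment> \<open>Level \<open>t\<close> is split as \<open>i + (t - i)\<close>: the
        union-intersection part is exact at level \<open>i\<close>, and the induction hypothesis
        handles the differences, whose sizes each drop by \<open>i\<close>.\<close>
      have "real (t - i) * min M (real (card (A - B')) + real (card (B' - A)) - real (t - i) - real \<beta>)
          \<le> real (pollard_sum (t - i) (A - B') (B' - A))"
        using less.prems B' False i cA cB by (intro less.hyps) auto
      moreover have "real (card (A - B')) + real (card (B' - A)) - real (t - i) - real \<beta>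
          = ?\<sigma> - real t - real i - real \<beta>"
        using cA cB False by linarith
      ultimately have 1: "real (t - i) * min M (?\<sigma> - real t - real i - real \<beta>)
          \<le> real (pollard_sum (t - i) (A - B') (B' - A))"
        by simp
      have "pollard_sum i (A \<union> B') (A \<inter> B') = card (A \<union> B') * i"
        using pollard_sum_card_right[of "A \<union> B'" "A \<inter> B'"] less.prems B' by (auto simp: i_def)
      moreover have "real (card (A \<union> B')) = ?\<sigma> - real i"
        using cU by linarith
      ultimately have 2: "real (pollard_sum i (A \<union> B') (A \<inter> B')) = real i * (?\<sigma> - real i)"
        by simp
      have "pollard_sum i (A \<union> B') (A \<inter> B') + pollard_sum (t - i) (A - B') (B' - A) \<le> pollard_sum t A B'"
        using pollard_sum_Un_Int_le[of A B' i "t - i"] less.prems B' False by simp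
      then have 3: "real i * (?\<sigma> - real i) + real (t - i) * min M (?\<sigma> - real t - real i - real \<beta>)
          \<le> real (pollard_sum t A B')"
        using 1 2 by linarith
      have "real t * ?\<mu> \<le> real i * (?\<sigma> - real i) + real (t - i) * min M (?\<sigma> - real t - real i - real \<beta>)"
      \<comment> \<open>If the inner minimum is \<open>M\<close>, both second factors dominate
        \<open>?\<mu>\<close>. Otherwise the linear estimate holds with a surplus of exactly
        \<open>i * \<beta>\<close>.\<close>
      proof (cases "M \<le> ?\<sigma> - real t - real i - real \<beta>")
        case True
        have "real i * ?\<mu> \<le> real i * (?\<sigma> - real i)"
          using False by (intro mult_left_mono) auto
        moreover have "real (t - i) * ?\<mu> \<le> real (t - i) * M"
          by (intro mult_left_mono) auto
        moreover have "real t * ?\<mu> = real i * ?\<mu> + real (t - i) * ?\<mu>"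
          using False by (simp add: of_nat_diff left_diff_distrib)
        ultimately show ?thesis
          using True by (simp add: min_absorb1)
      next
        case False': False
        have "real t * ?\<mu> \<le> real t * (?\<sigma> - real t - real \<beta>)"
          by (intro mult_left_mono) auto
        also have "\<dots> \<le> real i * (?\<sigma> - real i) + real (t - i) * (?\<sigma> - real t - real i - real \<beta>)"
          using False by (simp add: of_nat_diff algebra_simps)
        finally show ?thesis
          using False' by (simp add: min_absorb2)
      qed
      then show ?thesis
        using 3 by (simp add: eq)
    qed
  qed
qed

end

section \<open>Containers for sets with small doubling\<close>

lemma sum_card_Collect_swap:
  assumes "finite A" "finite B"
  shows "(\<Sum>a\<in>A. card {b \<in> B. R a b}) = (\<Sum>b\<in>B. card {a \<in> A. R a b})"
proof -
  have "(\<Sum>a\<in>A. card {b \<in> B. R a b}) = (\<Sum>a\<in>A. \<Sum>b\<in>B. if R a b then 1 else 0)"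
    using assms by (intro sum.cong refl) (simp add: sum.If_cases Int_def)
  also have "\<dots> = (\<Sum>b\<in>B. \<Sum>a\<in>A. if R a b then 1 else 0)"
    by (rule sum.swap)
  also have "\<dots> = (\<Sum>b\<in>B. card {a \<in> A. R a b})"
    using assms by (intro sum.cong refl) (simp add: sum.If_cases Int_def)
  finally show ?thesis .
qed

context comm_group
begin

section \<open>One stage: greedy cover, survivors and heavy elements\<close>

lemma card_translate_into_le:
  assumes "Z \<subseteq> carrier G" "a \<in> carrier G" "finite S"
  shows "card {v \<in> Z. v \<otimes> a \<in> S} \<le> card S"
proof (rule card_inj_on_le)
  show "inj_on (\<lambda>v. v \<otimes> a) {v \<in> Z. v \<otimes> a \<in> S}"
    using assms by (auto simp: inj_on_def subset_iff)
qed (use assms in auto)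

text \<open>A largest \<open>T'\<close> satisfying the invariant \<open>P\<close> replaces the
  greedy procedure: a bad \<open>v\<close> would add more than \<open>\<kappa> * card T\<close> new
  sums, so \<open>insert v T'\<close> would satisfy \<open>P\<close> too. Since all sums stay inside
  \<open>A <#> A\<close>, the invariant also bounds \<open>T'\<close>.\<close>

lemma greedy_cover:
  assumes A: "A \<subseteq> carrier G" "finite A" and T: "T \<subseteq> A" and S: "S \<subseteq> A <#> A" and \<kappa>: "0 \<le> \<kappa>"
  obtains T' where "T' \<subseteq> A" "\<kappa> * real (card T) * real (card T') \<le> real (card (A <#> A))"
    "\<And>v. v \<in> A \<Longrightarrow> real (card {a \<in> T. v \<otimes> a \<notin> S \<union> (T <#> T')}) \<le> \<kappa> * real (card T)"
proof -
  define P where "P T' \<longleftrightarrow> T' \<subseteq> A \<and> \<kappa> * real (card T) * real (card T') \<le> real (card (S \<union> (T <#> T')))" for T'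
  have fin: "finite T" "finite S"
    using assms by (auto intro: finite_subset)
  have "P {}"
    by (simp add: P_def)
  moreover have "\<forall>T'. P T' \<longrightarrow> card T' < Suc (card A)"
    using A by (auto simp: P_def less_Suc_eq_le intro: card_mono)
  ultimately obtain T' where T': "P T'" and max: "\<And>T''. P T'' \<Longrightarrow> card T'' \<le> card T'"
    using ex_has_greatest_nat[of P "{}" card "Suc (card A)"] by blast
  have T'A: "T' \<subseteq> A" "finite T'"
    using T' A by (auto simp: P_def intro: finite_subset)
  define S' where "S' = S \<union> (T <#> T')"
  have "S' \<subseteq> A <#> A"
    using S T T'A unfolding S'_def set_mult_def by blast
  then have "card S' \<le> card (A <#> A)"
    using A by (intro card_mono) auto
  then have "\<kappa> * real (card T) * real (card T') \<le> real (card (A <#> A))"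
    using T' by (simp add: P_def S'_def)
  moreover have "real (card {a \<in> T. v \<otimes> a \<notin> S'}) \<le> \<kappa> * real (card T)" if v: "v \<in> A" for v
  proof (rule ccontr)
    define D where "D = {a \<in> T. v \<otimes> a \<notin> S'}"
    assume "\<not> real (card {a \<in> T. v \<otimes> a \<notin> S'}) \<le> \<kappa> * real (card T)"
    then have D: "\<kappa> * real (card T) < real (card D)"
      by (simp add: D_def)
    moreover have "0 \<le> \<kappa> * real (card T)"
      using \<kappa> by simp
    ultimately have "D \<noteq> {}"
      by auto
    then obtain a where a: "a \<in> T" "v \<otimes> a \<notin> S'"
      by (auto simp: D_def)
    have comm: "a \<otimes> v = v \<otimes> a" if "a \<in> T" for a
      using that v A T by (auto intro: m_comm)
    have "v \<notin> T'"
      using a comm[of a] unfolding S'_def set_mult_def by force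
    have inj: "inj_on (\<lambda>a. v \<otimes> a) D"
      using v A T by (auto simp: inj_on_def D_def subset_iff)
    have sub: "S' \<union> (\<lambda>a. v \<otimes> a) ` D \<subseteq> S \<union> (T <#> insert v T')"
      using comm unfolding S'_def D_def set_mult_def by fastforce
    have "card S' + card D = card (S' \<union> (\<lambda>a. v \<otimes> a) ` D)"
      using fin T'A inj by (subst card_Un_disjoint) (auto simp: S'_def D_def card_image)
    also have "\<dots> \<le> card (S \<union> (T <#> insert v T'))"
      using sub fin T'A by (intro card_mono) auto
    finally have "real (card S') + real (card D) \<le> real (card (S \<union> (T <#> insert v T')))"
      by linarith
    moreover have "\<kappa> * real (card T) * real (card T') \<le> real (card S')"
      using T' by (simp add: P_def S'_def)
    ultimately have "P (insert v T')"
      using D \<open>v \<notin> T'\<close> T'A v by (simp add: P_def algebra_simps)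
    from max[OF this] show False
      using \<open>v \<notin> T'\<close> T'A by simp
  qed
  ultimately show ?thesis
    using that[of T'] T'A by (simp add: S'_def)
qed

definition survivors :: "real \<Rightarrow> 'a set \<Rightarrow> 'a set \<Rightarrow> 'a set \<Rightarrow> 'a set" where
  "survivors \<kappa> T S Z = {v \<in> Z. real (card {a \<in> T. v \<otimes> a \<notin> S}) \<le> \<kappa> * real (card T)}"

definition heavy :: "real \<Rightarrow> 'a set \<Rightarrow> 'a set \<Rightarrow> 'a set" where
  "heavy \<theta> Z S = {u \<in> Z. \<theta> \<le> real (card {v \<in> Z. v \<otimes> u \<notin> S})}"

text \<open>Double counting of the pairs with sum in \<open>S\<close>: each survivor is in at least
  \<open>card T / 2\<close> of them, each element of \<open>T\<close> in at most
  \<open>card S\<close>.\<close>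

lemma card_survivors_le:
  assumes "Z \<subseteq> carrier G" "finite Z" "T \<subseteq> carrier G" "finite T" "T \<noteq> {}" "finite S" "\<kappa> \<le> 1 / 2"
  shows "card (survivors \<kappa> T S Z) \<le> 2 * card S"
proof -
  let ?Z = "survivors \<kappa> T S Z"
  have Z: "finite ?Z" "?Z \<subseteq> carrier G"
    using assms by (auto simp: survivors_def)
  have T: "0 < real (card T)"
    using assms by (simp add: card_gt_0_iff)
  have "real (card ?Z) * (real (card T) / 2) = (\<Sum>v\<in>?Z. real (card T) / 2)"
    by simp
  also have "\<dots> \<le> (\<Sum>v\<in>?Z. real (card {a \<in> T. v \<otimes> a \<in> S}))"
  proof (rule sum_mono)
    fix v assume v: "v \<in> ?Z"
    have "T = {a \<in> T. v \<otimes> a \<in> S} \<union> {a \<in> T. v \<otimes> a \<notin> S}"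
      by auto
    then have "card T = card {a \<in> T. v \<otimes> a \<in> S} + card {a \<in> T. v \<otimes> a \<notin> S}"
      using assms by (subst card_Un_disjoint[symmetric]) auto
    moreover have "real (card {a \<in> T. v \<otimes> a \<notin> S}) \<le> \<kappa> * real (card T)"
      using v by (simp add: survivors_def)
    moreover have "\<kappa> * real (card T) \<le> 1 / 2 * real (card T)"
      using assms by (intro mult_right_mono) auto
    ultimately show "real (card T) / 2 \<le> real (card {a \<in> T. v \<otimes> a \<in> S})"
      by linarith
  qed
  also have "\<dots> = real (\<Sum>v\<in>?Z. card {a \<in> T. v \<otimes> a \<in> S})"
    by simp
  also have "(\<Sum>v\<in>?Z. card {a \<in> T. v \<otimes> a \<in> S}) = (\<Sum>a\<in>T. card {v \<in> ?Z. v \<otimes> a \<in> S})"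
    using Z assms by (intro sum_card_Collect_swap) auto
  also have "\<dots> \<le> (\<Sum>a\<in>T. card S)"
    using Z assms by (intro sum_mono card_translate_into_le) auto
  finally have "real (card ?Z) * (real (card T) / 2) \<le> real (card T) * real (card S)"
    by simp
  then have "real (card ?Z) \<le> 2 * real (card S)"
    using T by (simp add: field_simps)
  then show ?thesis
    by linarith
qed

text \<open>\<open>card Z - card S\<close> is the potential that forces termination. Each heavy
  \<open>a\<close> in \<open>T\<close> has at least \<open>\<theta>\<close> sums with
  \<open>Z\<close> outside \<open>S\<close>. At most \<open>card (S' - S)\<close> of them become
  covered; over all of \<open>T\<close>, the others are charged to removed elements, at most
  \<open>card T\<close> each, or to survivors, at most \<open>\<kappa> * card T\<close>
  each.\<close>

lemma card_survivors_decrease: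
  assumes "Z \<subseteq> carrier G" "finite Z" "finite S'" "S \<subseteq> S'" "T \<subseteq> heavy \<theta> Z S" "T \<noteq> {}" "0 \<le> \<kappa>"
  shows "real (card (survivors \<kappa> T S' Z)) - real (card S')
    \<le> real (card Z) - real (card S) - (\<theta> - \<kappa> * real (card Z))"
proof -
  let ?Z = "survivors \<kappa> T S' Z"
  have T: "T \<subseteq> Z" "finite T" "T \<subseteq> carrier G"
    using assms by (auto simp: heavy_def intro: finite_subset)
  have Z: "finite ?Z" "?Z \<subseteq> Z"
    using assms by (auto simp: survivors_def)
  have cS: "card (S' - S) = card S' - card S" "card S \<le> card S'"
    using assms by (auto intro!: card_Diff_subset card_mono intro: finite_subset)
  have cZ: "card (Z - ?Z) = card Z - card ?Z" "card ?Z \<le> card Z"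
    using assms Z by (auto intro!: card_Diff_subset card_mono)
  have T0: "0 < real (card T)"
    using T assms by (simp add: card_gt_0_iff)
  have "real (card T) * \<theta> = (\<Sum>a\<in>T. \<theta>)"
    by simp
  also have "\<dots> \<le> (\<Sum>a\<in>T. real (card {v \<in> Z. v \<otimes> a \<notin> S}))"
    using assms by (intro sum_mono) (auto simp: heavy_def)
  also have "\<dots> \<le> (\<Sum>a\<in>T. real (card (S' - S)) + real (card {v \<in> Z. v \<otimes> a \<notin> S'}))"
  proof (rule sum_mono)
    fix a assume a: "a \<in> T"
    have "card {v \<in> Z. v \<otimes> a \<notin> S} \<le> card ({v \<in> Z. v \<otimes> a \<in> S' - S} \<union> {v \<in> Z. v \<otimes> a \<notin> S'})"
      using assms by (intro card_mono) auto
    also have "\<dots> \<le> card {v \<in> Z. v \<otimes> a \<in> S' - S} + card {v \<in> Z. v \<otimes> a \<notin> S'}"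
      by (rule card_Un_le)
    also have "card {v \<in> Z. v \<otimes> a \<in> S' - S} \<le> card (S' - S)"
      using a T assms by (intro card_translate_into_le) auto
    finally show "real (card {v \<in> Z. v \<otimes> a \<notin> S}) \<le> real (card (S' - S)) + real (card {v \<in> Z. v \<otimes> a \<notin> S'})"
      by simp
  qed
  also have "\<dots> = real (card T) * (real (card S') - real (card S)) + real (\<Sum>a\<in>T. card {v \<in> Z. v \<otimes> a \<notin> S'})"
    using cS by (simp add: sum.distrib of_nat_diff)
  also have "(\<Sum>a\<in>T. card {v \<in> Z. v \<otimes> a \<notin> S'}) = (\<Sum>v\<in>Z. card {a \<in> T. v \<otimes> a \<notin> S'})"
    using T assms by (intro sum_card_Collect_swap) auto
  also have "\<dots> = (\<Sum>v\<in>Z - ?Z. card {a \<in> T. v \<otimes> a \<notin> S'}) + (\<Sum>v\<in>?Z. card {a \<in> T. v \<otimes> a \<notin> S'})"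
    using Z assms by (simp add: sum.subset_diff)
  also have "real \<dots> \<le> (real (card Z) - real (card ?Z)) * real (card T) + real (card Z) * (\<kappa> * real (card T))"
  proof -
    have "(\<Sum>v\<in>Z - ?Z. card {a \<in> T. v \<otimes> a \<notin> S'}) \<le> (\<Sum>v\<in>Z - ?Z. card T)"
      using T by (intro sum_mono card_mono) auto
    then have "real (\<Sum>v\<in>Z - ?Z. card {a \<in> T. v \<otimes> a \<notin> S'}) \<le> real (card (Z - ?Z) * card T)"
      by (simp only: of_nat_le_iff sum_constant of_nat_id)
    moreover have "real (card (Z - ?Z) * card T) = (real (card Z) - real (card ?Z)) * real (card T)"
      using cZ by (simp add: of_nat_diff)
    moreover have "(\<Sum>v\<in>?Z. real (card {a \<in> T. v \<otimes> a \<notin> S'})) \<le> (\<Sum>v\<in>?Z. \<kappa> * real (card T))"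
      by (intro sum_mono) (auto simp: survivors_def)
    moreover have "(\<Sum>v\<in>?Z. \<kappa> * real (card T)) \<le> real (card Z) * (\<kappa> * real (card T))"
      using cZ assms T0 by (auto intro: mult_right_mono)
    ultimately show ?thesis
      unfolding of_nat_add of_nat_sum by linarith
  qed
  finally have "real (card T) * \<theta> \<le> real (card T) * (real (card S') - real (card S)
      + (real (card Z) - real (card ?Z)) + real (card Z) * \<kappa>)"
    by (simp add: algebra_simps)
  then have "\<theta> \<le> real (card S') - real (card S) + (real (card Z) - real (card ?Z)) + real (card Z) * \<kappa>"
    using T0 by simp
  then show ?thesis
    by (simp add: algebra_simps)
qed

text \<open>If the light set \<open>C\<close> were too large, \<open>pollard_sum_ge\<close> at level
  t near \<gamma> m / 2 would give at least t (m + \<gamma> m / 2). But sums in \<open>S\<close>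
  contribute at most t m, and the other pairs number at most 2 m times the lightness
  threshold.\<close>

lemma card_light_le:
  fixes m :: nat
  assumes Z: "Z \<subseteq> carrier G" "finite Z" "card Z \<le> 2 * m" and S: "finite S" "card S \<le> m"
    and \<gamma>: "0 < \<gamma>" "\<gamma> \<le> 1" "4 \<le> \<gamma> * real m"
    and beta: "\<And>H. subgroup H G \<Longrightarrow> finite H \<Longrightarrow> real (card H) \<le> (1 + \<gamma>) * real m \<Longrightarrow> card H \<le> \<beta>"
  shows "real (card (Z - heavy (\<gamma>\<^sup>2 / 17 * real m) Z S)) \<le> (1 + \<gamma>) * ((real m + real \<beta>) / 2)"
proof (rule ccontr)
  define C where "C = Z - heavy (\<gamma>\<^sup>2 / 17 * real m) Z S"
  assume "\<not> ?thesis"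
  then have big: "(1 + \<gamma>) * ((real m + real \<beta>) / 2) < real (card C)"
    by (simp add: C_def)
  have C: "C \<subseteq> Z" "C \<subseteq> carrier G" "finite C" "card C \<le> 2 * m"
    using Z card_mono[of Z C] by (auto simp: C_def)
  \<comment> \<open>Small enough to keep 2 |C| - t - \<beta> above m + \<gamma> m / 2; since
    \<open>4 \<le> \<gamma> * real m\<close>, rounding down still leaves at least \<gamma> m /
    4.\<close>
  define t where "t = nat \<lfloor>\<gamma> * real m / 2\<rfloor>"
  have t: "real t \<le> \<gamma> * real m / 2" "\<gamma> * real m / 4 \<le> real t" "1 \<le> t"
    using \<gamma> unfolding t_def by linarith+
  have m0: "0 < real m"
    using \<gamma> by (metis not_le of_nat_0_le_iff less_eq_real_def mult_zero_right not_numeral_le_zero)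
  have \<gamma>m: "\<gamma> * real m \<le> real m"
    using \<gamma> by (simp add: mult_left_le_one_le)
  have big': "real m + real \<beta> + \<gamma> * real m < 2 * real (card C)"
  proof -
    have "0 \<le> \<gamma> * real \<beta>"
      using \<gamma> by simp
    with big show ?thesis
      by (simp add: algebra_simps)
  qed
  have tC: "t \<le> card C"
    using big' t \<gamma>m by linarith
  have "real t * (real m + \<gamma> * real m / 2)
      \<le> real t * min ((1 + \<gamma>) * real m) (real (card C) + real (card C) - real t - real \<beta>)"
    using big' t \<gamma> by (intro mult_left_mono) (auto simp: algebra_simps)
  also have "\<dots> \<le> real (pollard_sum t C C)"
    using C t tC beta by (intro pollard_sum_ge) auto
  also have "pollard_sum t C C = (\<Sum>x\<in>(C <#> C) \<inter> S. min t (rep C C x)) + (\<Sum>x\<in>(C <#> C) - S. min t (rep C C x))"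
    unfolding pollard_sum_def using C by (subst sum.Int_Diff[of _ _ S]) auto
  also have "\<dots> \<le> (\<Sum>x\<in>(C <#> C) \<inter> S. t) + (\<Sum>x\<in>(C <#> C) - S. rep C C x)"
    by (intro add_mono sum_mono) auto
  also have "(\<Sum>x\<in>(C <#> C) - S. rep C C x) = card {p \<in> C \<times> C. fst p \<otimes> snd p \<in> (C <#> C) - S}"
    using C by (intro sum_rep) auto
  \<comment> \<open>Pairs are regrouped by their second entry, the one whose lightness is
    used.\<close>
  also have "{p \<in> C \<times> C. fst p \<otimes> snd p \<in> (C <#> C) - S} = prod.swap ` (SIGMA u:C. {v \<in> C. v \<otimes> u \<notin> S})"
    by (force simp: set_mult_def image_iff)
  also have "card \<dots> = card (SIGMA u:C. {v \<in> C. v \<otimes> u \<notin> S})"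
    by (intro card_image) (auto simp: inj_on_def)
  also have "\<dots> = (\<Sum>u\<in>C. card {v \<in> C. v \<otimes> u \<notin> S})"
    using C by (intro card_SigmaI) auto
  also have "(\<Sum>x\<in>(C <#> C) \<inter> S. t) \<le> m * t"
    using S card_mono[of S "(C <#> C) \<inter> S"] by (auto intro: mult_right_mono order_trans)
  finally have 1: "real t * (real m + \<gamma> * real m / 2) \<le> real m * real t + (\<Sum>u\<in>C. real (card {v \<in> C. v \<otimes> u \<notin> S}))"
    by simp
  have "(\<Sum>u\<in>C. real (card {v \<in> C. v \<otimes> u \<notin> S})) \<le> (\<Sum>u\<in>C. \<gamma>\<^sup>2 / 17 * real m)"
  proof (rule sum_mono)
    fix u assume u: "u \<in> C"
    have "card {v \<in> C. v \<otimes> u \<notin> S} \<le> card {v \<in> Z. v \<otimes> u \<notin> S}"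
      using Z C by (intro card_mono) auto
    moreover have "real (card {v \<in> Z. v \<otimes> u \<notin> S}) < \<gamma>\<^sup>2 / 17 * real m"
      using u by (auto simp: C_def heavy_def)
    ultimately show "real (card {v \<in> C. v \<otimes> u \<notin> S}) \<le> \<gamma>\<^sup>2 / 17 * real m"
      by linarith
  qed
  also have "\<dots> = real (card C) * (\<gamma>\<^sup>2 / 17 * real m)"
    by simp
  also have "\<dots> \<le> 2 * real m * (\<gamma>\<^sup>2 / 17 * real m)"
    using C \<gamma> by (intro mult_right_mono) auto
  finally have "real t * (\<gamma> * real m / 2) \<le> 2 * real m * (\<gamma>\<^sup>2 / 17 * real m)"
    using 1 by (simp add: algebra_simps)
  moreover have "\<gamma> * real m / 4 * (\<gamma> * real m / 2) \<le> real t * (\<gamma> * real m / 2)"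
    using t \<gamma> by (intro mult_right_mono) auto
  ultimately have "\<gamma> * real m / 4 * (\<gamma> * real m / 2) \<le> 2 * real m * (\<gamma>\<^sup>2 / 17 * real m)"
    by linarith
  \<comment> \<open>The contradiction rests on 2 / 17 < 1 / 8; any constant above 16 would serve in
    the threshold.\<close>
  then have "(\<gamma> * real m)\<^sup>2 * (1 / 8 - 2 / 17) \<le> 0"
    by (simp add: power2_eq_square algebra_simps)
  moreover have "0 < (\<gamma> * real m)\<^sup>2"
    using \<gamma> m0 by simp
  ultimately show False
    by simp
qed

section \<open>The stages of the container construction\<close>

text \<open>A state \<open>(Z, S)\<close> records that \<open>A \<subseteq> Z\<close> and \<open>S \<subseteq> A + A\<close> for the set \<open>A\<close> being fingerprinted.
  The empty fingerprint changes nothing, so states of earlier stages persist.\<close>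

primrec container_states :: "real \<Rightarrow> nat \<Rightarrow> 'a set \<Rightarrow> nat \<Rightarrow> ('a set \<times> 'a set) set" where
  "container_states \<kappa> k Y 0 = {(Y, {})}"
| "container_states \<kappa> k Y (Suc j) =
    (\<lambda>((T, T'), (Z, S)). (survivors \<kappa> T (S \<union> (T <#> T')) Z, S \<union> (T <#> T'))) `
      (({T. T \<subseteq> Y \<and> card T \<le> k} \<times> {T. T \<subseteq> Y \<and> card T \<le> k}) \<times> container_states \<kappa> k Y j)"

lemma container_states_SucI:
  assumes "(Z, S) \<in> container_states \<kappa> k Y j" "T \<subseteq> Y" "card T \<le> k" "T' \<subseteq> Y" "card T' \<le> k"
  shows "(survivors \<kappa> T (S \<union> (T <#> T')) Z, S \<union> (T <#> T')) \<in> container_states \<kappa> k Y (Suc j)"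
  unfolding container_states.simps using assms
  by (intro image_eqI[where x = "((T, T'), (Z, S))"]) auto

lemma container_states_Suc_mono: "container_states \<kappa> k Y j \<subseteq> container_states \<kappa> k Y (Suc j)"
proof clarify
  fix Z S assume "(Z, S) \<in> container_states \<kappa> k Y j"
  from container_states_SucI[OF this, of "{}" "{}"]
  show "(Z, S) \<in> container_states \<kappa> k Y (Suc j)"
    by (simp add: survivors_def set_mult_def)
qed

text \<open>Each stage chooses two sets of at most \<open>k\<close> elements, hence the exponent
  \<open>2 * j\<close>.\<close>

lemma card_container_states:
  assumes "finite Y"
  shows "finite (container_states \<kappa> k Y j) \<and>
    card (container_states \<kappa> k Y j) \<le> card {T. T \<subseteq> Y \<and> card T \<le> k} ^ (2 * j)"
proof (induction j)
  case (Suc j)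
  let ?Q = "{T. T \<subseteq> Y \<and> card T \<le> k}"
  have Q: "finite ?Q"
    using assms by simp
  have "card (container_states \<kappa> k Y (Suc j)) \<le> card ((?Q \<times> ?Q) \<times> container_states \<kappa> k Y j)"
    unfolding container_states.simps using Q Suc by (intro card_image_le) auto
  also have "\<dots> = card ?Q * card ?Q * card (container_states \<kappa> k Y j)"
    by (simp add: card_cartesian_product)
  also have "\<dots> \<le> card ?Q * card ?Q * card ?Q ^ (2 * j)"
    using Suc by (intro mult_left_mono) auto
  finally show ?case
    using Q Suc by (simp add: mult.assoc)
qed simp

text \<open>One stage for a given \<open>A\<close>. Here \<open>T'\<close> comes from
  \<open>greedy_cover\<close>, and the last hypothesis makes it small enough to be an admissible
  fingerprint. \<open>A\<close> survives because no element of it is left with many uncovered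
  sums.\<close>

lemma refine_state:
  fixes m :: nat
  assumes A: "A \<subseteq> Y" "Y \<subseteq> carrier G" "finite Y" "card (A <#> A) \<le> m"
    and st: "(Z, S) \<in> container_states \<kappa> k Y j" "A \<subseteq> Z" "Z \<subseteq> Y" "S \<subseteq> A <#> A"
    and T: "T \<subseteq> A" "T \<noteq> {}" "card T \<le> k" and \<kappa>: "0 < \<kappa>" "\<kappa> \<le> 1 / 2"
    and k: "real m \<le> \<kappa> * real (card T) * real k"
  obtains S' where "(survivors \<kappa> T S' Z, S') \<in> container_states \<kappa> k Y (Suc j)"
    "A \<subseteq> survivors \<kappa> T S' Z" "S \<subseteq> S'" "S' \<subseteq> A <#> A" "card (survivors \<kappa> T S' Z) \<le> 2 * m"
proof -
  have "finite A" "finite Z" "A \<subseteq> carrier G"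
    using A st by (auto intro: finite_subset)
  moreover from this have "finite T"
    using T by (auto intro: finite_subset)
  ultimately have fin: "finite A" "A \<subseteq> carrier G" "finite T" "finite Z"
    by blast+
  obtain T' where T': "T' \<subseteq> A" "\<kappa> * real (card T) * real (card T') \<le> real (card (A <#> A))"
    "\<And>v. v \<in> A \<Longrightarrow> real (card {a \<in> T. v \<otimes> a \<notin> S \<union> (T <#> T')}) \<le> \<kappa> * real (card T)"
    using greedy_cover[of A T S \<kappa>] fin T st \<kappa> by auto
  have pos: "0 < \<kappa> * real (card T)"
    using \<kappa> T fin by (simp add: card_gt_0_iff)
  have "\<kappa> * real (card T) * real (card T') \<le> \<kappa> * real (card T) * real k"
    using T'(2) k A by linarith
  then have "card T' \<le> k"
    using pos by (metis mult_le_cancel_left_pos of_nat_le_iff)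
  define S' where "S' = S \<union> (T <#> T')"
  have "(survivors \<kappa> T S' Z, S') \<in> container_states \<kappa> k Y (Suc j)"
    unfolding S'_def using st A T T' \<open>card T' \<le> k\<close> by (intro container_states_SucI) auto
  moreover have "A \<subseteq> survivors \<kappa> T S' Z"
    using T'(3) st(2) unfolding survivors_def S'_def by blast
  moreover have S': "S' \<subseteq> A <#> A"
    using st(4) mono_set_mult[OF T(1) T'(1)] by (auto simp: S'_def)
  moreover have "card (survivors \<kappa> T S' Z) \<le> 2 * m"
  proof -
    have "finite S'"
      using S' fin by (auto intro: finite_subset)
    then have "card (survivors \<kappa> T S' Z) \<le> 2 * card S'"
      using fin T A st \<kappa> by (intro card_survivors_le) auto
    also have "card S' \<le> card (A <#> A)"
      using S' fin by (intro card_mono) auto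
    finally show ?thesis
      using A by simp
  qed
  ultimately show ?thesis
    using that[of S'] by (simp add: S'_def)
qed

text \<open>The first stage takes an arbitrary \<open>T\<close>, to bring \<open>Z\<close> down to 2
  m elements; hence the shift to \<open>Suc j\<close>. Later, either \<open>A\<close> has few heavy
  elements and the state is kept, or \<open>T\<close> is chosen among them and the potential drops
  by at least 4 \<kappa> m - \<kappa> (2 m).\<close>

lemma container_states_progress:
  fixes m t :: nat
  assumes A: "A \<subseteq> Y" "Y \<subseteq> carrier G" "finite Y" "card (A <#> A) \<le> m"
    and t: "0 < t" "t \<le> card A" "t \<le> k" "real m \<le> \<kappa> * real t * real k"
    and \<kappa>: "0 < \<kappa>" "\<kappa> \<le> 1 / 8"
  shows "\<exists>Z S. (Z, S) \<in> container_states \<kappa> k Y (Suc j) \<and> A \<subseteq> Z \<and> Z \<subseteq> Y \<and> S \<subseteq> A <#> A \<and> card Z \<le> 2 * m \<and>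
    (card (A \<inter> heavy (4 * \<kappa> * real m) Z S) < t \<or>
      real (card Z) - real (card S) \<le> 2 * real m - real j * (2 * \<kappa> * real m))"
proof (induction j)
  case 0
  obtain T where T: "T \<subseteq> A" "card T = t"
    using obtain_subset_with_card_n[OF t(2)] by blast
  have T0: "T \<noteq> {}"
    using T t by auto
  obtain S' where S': "(survivors \<kappa> T S' Y, S') \<in> container_states \<kappa> k Y (Suc 0)"
    "A \<subseteq> survivors \<kappa> T S' Y" "S' \<subseteq> A <#> A" "card (survivors \<kappa> T S' Y) \<le> 2 * m"
    using refine_state[of A Y m Y "{}" \<kappa> k 0 T] A T T0 t \<kappa> by (auto simp del: container_states.simps(2))
  moreover have "survivors \<kappa> T S' Y \<subseteq> Y"
    by (auto simp: survivors_def)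
  moreover have "real (card (survivors \<kappa> T S' Y)) - real (card S') \<le> 2 * real m - real 0 * (2 * \<kappa> * real m)"
    using S'(4) by simp
  ultimately show ?case
    by blast
next
  case (Suc j)
  then obtain Z S where st: "(Z, S) \<in> container_states \<kappa> k Y (Suc j)" "A \<subseteq> Z" "Z \<subseteq> Y"
      "S \<subseteq> A <#> A" "card Z \<le> 2 * m"
    and alt: "card (A \<inter> heavy (4 * \<kappa> * real m) Z S) < t \<or>
      real (card Z) - real (card S) \<le> 2 * real m - real j * (2 * \<kappa> * real m)"
    by blast
  show ?case
  proof (cases "card (A \<inter> heavy (4 * \<kappa> * real m) Z S) < t")
    case True
    then show ?thesis
      using st container_states_Suc_mono by blast
  next
    case False
    then obtain T where T: "T \<subseteq> A \<inter> heavy (4 * \<kappa> * real m) Z S" "card T = t"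
      using obtain_subset_with_card_n[of t] by (metis not_le_imp_less)
    have T0: "T \<noteq> {}"
      using T t by auto
    obtain S' where S': "(survivors \<kappa> T S' Z, S') \<in> container_states \<kappa> k Y (Suc (Suc j))"
      "A \<subseteq> survivors \<kappa> T S' Z" "S \<subseteq> S'" "S' \<subseteq> A <#> A" "card (survivors \<kappa> T S' Z) \<le> 2 * m"
      using refine_state[of A Y m Z S \<kappa> k "Suc j" T] A T T0 t \<kappa> st
      by (auto simp del: container_states.simps(2))
    have "finite A" "finite Z"
      using A st by (auto intro: finite_subset)
    then have "finite S'"
      using S' by (auto intro: finite_subset)
    then have "real (card (survivors \<kappa> T S' Z)) - real (card S')
        \<le> real (card Z) - real (card S) - (4 * \<kappa> * real m - \<kappa> * real (card Z))"
      using T T0 S' A st \<kappa> \<open>finite Z\<close> by (intro card_survivors_decrease) auto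
    also have "\<kappa> * real (card Z) \<le> \<kappa> * (2 * real m)"
      using st \<kappa> by (intro mult_left_mono) auto
    also have "real (card Z) - real (card S) \<le> 2 * real m - real j * (2 * \<kappa> * real m)"
      using alt False by simp
    finally have "real (card (survivors \<kappa> T S' Z)) - real (card S') \<le> 2 * real m - real (Suc j) * (2 * \<kappa> * real m)"
      by (simp add: algebra_simps)
    moreover have "survivors \<kappa> T S' Z \<subseteq> Y"
      using st by (auto simp: survivors_def)
    ultimately show ?thesis
      using S' by blast
  qed
qed

text \<open>The potential is at most 2 m after the first stage and never below -m, as
  \<open>card S \<le> m\<close>; so \<open>j\<close> drops of 2 \<kappa> m are impossible, and
  \<open>A\<close> ends with few heavy elements. The value 68 = 4 * 17 matches the threshold
  \<open>4 * \<kappa> * real m\<close> with that of \<open>card_light_le\<close>.\<close>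

theorem small_doubling_containers:
  fixes m t k j :: nat
  assumes Y: "Y \<subseteq> carrier G" "finite Y"
    and \<gamma>: "0 < \<gamma>" "\<gamma> \<le> 1" "4 \<le> \<gamma> * real m"
    and \<kappa>: "\<kappa> = \<gamma>\<^sup>2 / 68" and j: "3 < real j * (2 * \<kappa>)"
    and t: "0 < t" "t \<le> k" "real m \<le> \<kappa> * real t * real k"
    and beta: "\<And>H. subgroup H G \<Longrightarrow> finite H \<Longrightarrow> real (card H) \<le> (1 + \<gamma>) * real m \<Longrightarrow> card H \<le> \<beta>"
  obtains \<C> where "finite \<C>" "card \<C> \<le> card {T. T \<subseteq> Y \<and> card T \<le> k} ^ (2 * Suc j)"
    "\<And>C. C \<in> \<C> \<Longrightarrow> finite C \<and> real (card C) \<le> (1 + \<gamma>) * ((real m + real \<beta>) / 2)"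
    "\<And>A. A \<subseteq> Y \<Longrightarrow> t \<le> card A \<Longrightarrow> card (A <#> A) \<le> m \<Longrightarrow> \<exists>C\<in>\<C>. card (A - C) < t"
proof -
  define \<theta> where "\<theta> = \<gamma>\<^sup>2 / 17 * real m"
  \<comment> \<open>Filtering by size spares any claim about states that arise from no set of small
    doubling.\<close>
  define \<C> where "\<C> = {C \<in> (\<lambda>(Z, S). Z - heavy \<theta> Z S) ` container_states \<kappa> k Y (Suc j).
    finite C \<and> real (card C) \<le> (1 + \<gamma>) * ((real m + real \<beta>) / 2)}"
  have \<theta>: "\<theta> = 4 * \<kappa> * real m"
    by (simp add: \<theta>_def \<kappa>)
  have m0: "0 < real m"
    using \<gamma> by (metis not_le of_nat_0_le_iff less_eq_real_def mult_zero_right not_numeral_le_zero)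
  have \<kappa>': "0 < \<kappa>" "\<kappa> \<le> 1 / 8"
    using \<gamma> power_le_one[of \<gamma> 2] by (auto simp: \<kappa>)
  note states = card_container_states[OF Y(2), of \<kappa> k "Suc j"]
  have fin: "finite ((\<lambda>(Z, S). Z - heavy \<theta> Z S) ` container_states \<kappa> k Y (Suc j))"
    using states by blast
  have "card \<C> \<le> card ((\<lambda>(Z, S). Z - heavy \<theta> Z S) ` container_states \<kappa> k Y (Suc j))"
    using fin by (intro card_mono) (auto simp: \<C>_def)
  also have "\<dots> \<le> card (container_states \<kappa> k Y (Suc j))"
    using states by (intro card_image_le) blast
  finally have card: "card \<C> \<le> card {T. T \<subseteq> Y \<and> card T \<le> k} ^ (2 * Suc j)"
    using states by linarith
  have cover: "\<exists>C\<in>\<C>. card (A - C) < t"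
    if A: "A \<subseteq> Y" "t \<le> card A" "card (A <#> A) \<le> m" for A
  proof -
    obtain Z S where st: "(Z, S) \<in> container_states \<kappa> k Y (Suc j)" "A \<subseteq> Z" "Z \<subseteq> Y"
        "S \<subseteq> A <#> A" "card Z \<le> 2 * m"
      and alt: "card (A \<inter> heavy \<theta> Z S) < t \<or> real (card Z) - real (card S) \<le> 2 * real m - real j * (2 * \<kappa> * real m)"
      using container_states_progress[of A Y m t k \<kappa> j] A Y t \<kappa>' unfolding \<theta> by blast
    have fin: "finite A" "finite Z"
      using A Y st by (auto intro: finite_subset)
    then have S: "finite S" "card S \<le> m"
      using A st card_mono[of "A <#> A" S] by (auto intro: finite_subset)
    have "3 * real m < real j * (2 * \<kappa>) * real m"
      using j m0 by (intro mult_strict_right_mono) auto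
    then have small: "card (A \<inter> heavy \<theta> Z S) < t"
      using alt S by (auto simp: mult.assoc)
    have "real (card (Z - heavy \<theta> Z S)) \<le> (1 + \<gamma>) * ((real m + real \<beta>) / 2)"
      unfolding \<theta>_def using fin S st Y \<gamma> beta by (intro card_light_le) auto
    then have "Z - heavy \<theta> Z S \<in> \<C>"
      using st fin by (force simp: \<C>_def simp del: container_states.simps)
    moreover have "A - (Z - heavy \<theta> Z S) = A \<inter> heavy \<theta> Z S"
      using st by auto
    ultimately show ?thesis
      using small by metis
  qed
  show ?thesis
  proof (rule that[OF _ card _ cover])
    show "finite \<C>"
      unfolding \<C>_def using fin by (rule rev_finite_subset) blast
    show "finite C \<and> real (card C) \<le> (1 + \<gamma>) * ((real m + real \<beta>) / 2)" if "C \<in> \<C>" for C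
      using that unfolding \<C>_def by blast
  qed
qed

end

section \<open>Counting\<close>

text \<open>Small sets are ranges of short lists; as \<open>card Y\<close> is at least 2, the
  geometric sum is absorbed by one extra factor \<open>card Y\<close>.\<close>

lemma card_subsets_bounded_le:
  assumes "finite Y" "2 \<le> card Y"
  shows "card {T. T \<subseteq> Y \<and> card T \<le> k} \<le> card Y ^ Suc k"
proof -
  let ?L = "{xs. set xs \<subseteq> Y \<and> length xs \<le> k}"
  have "{T. T \<subseteq> Y \<and> card T \<le> k} \<subseteq> set ` ?L"
  proof clarify
    fix T assume T: "T \<subseteq> Y" "card T \<le> k"
    then obtain xs where "set xs = T" "distinct xs"
      using assms finite_distinct_list[of T] finite_subset by blast
    then show "T \<in> set ` ?L"
      using T distinct_card[of xs] by (intro image_eqI[of _ _ xs]) auto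
  qed
  then have "card {T. T \<subseteq> Y \<and> card T \<le> k} \<le> card ?L"
    using assms finite_lists_length_le[of Y k] by (meson surj_card_le)
  also have "\<dots> = (\<Sum>i\<le>k. card Y ^ i)"
    using assms by (simp add: card_lists_length_le)
  also have "\<dots> \<le> card Y ^ Suc k"
  proof (induction k)
    case (Suc k)
    have "(\<Sum>i\<le>Suc k. card Y ^ i) \<le> 2 * card Y ^ Suc k"
      using Suc by simp
    also have "\<dots> \<le> card Y * card Y ^ Suc k"
      using assms by (intro mult_right_mono) auto
    finally show ?case by simp
  qed (use assms in simp)
  finally show ?thesis .
qed

text \<open>Adjoining \<open>j\<close> fixed new points turns (s - j)-subsets injectively into
  s-subsets; formally, Pascal's rule is iterated.\<close>

lemma binomial_diff_le:
  assumes "j \<le> s"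
  shows "R choose (s - j) \<le> (R + j) choose s"
  using assms
proof (induction j arbitrary: s)
  case (Suc j)
  then obtain s' where s: "s = Suc s'" "j \<le> s'"
    by (cases s) auto
  have "R choose (s' - j) \<le> (R + j) choose s'"
    using Suc.IH s by simp
  also have "\<dots> \<le> Suc (R + j) choose Suc s'"
    by simp
  finally show ?case
    using s by simp
qed simp

text \<open>\<open>A\<close> is recovered from \<open>A - C\<close> and \<open>A \<inter> C\<close>.
  Enlarging \<open>R\<close> by \<open>t\<close> compensates for the elements outside
  \<open>C\<close>, and \<open>t \<le> k\<close> lets the fingerprint count bound the choices of
  \<open>A - C\<close>.\<close>

lemma card_almost_subsets_le:
  assumes "finite Y" "finite C" "card C \<le> R" "t \<le> k"
  shows "card {A. A \<subseteq> Y \<and> card A = s \<and> card (A - C) < t}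
    \<le> card {T. T \<subseteq> Y \<and> card T \<le> k} * ((R + t) choose s)"
proof -
  let ?Q = "{T. T \<subseteq> Y \<and> card T \<le> k}"
  let ?X = "{A. A \<subseteq> Y \<and> card A = s \<and> card (A - C) < t}"
  let ?P = "SIGMA J:{T \<in> ?Q. card T \<le> s \<and> card T < t}. {B. B \<subseteq> C \<and> card B = s - card J}"
  have fin: "finite {T \<in> ?Q. card T \<le> s \<and> card T < t}"
    using assms by simp
  have "card ?X \<le> card ?P"
  proof (rule card_inj_on_le)
    show "inj_on (\<lambda>A. (A - C, A \<inter> C)) ?X"
      by (auto simp: inj_on_def)
    show "(\<lambda>A. (A - C, A \<inter> C)) ` ?X \<subseteq> ?P"
    proof clarsimp
      fix A assume A: "A \<subseteq> Y" "card (A - C) < t"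
      then have "finite A"
        using assms finite_subset by blast
      then have "card A = card (A \<inter> C) + card (A - C)"
        by (rule card_Int_Diff)
      then show "A - C \<subseteq> Y \<and> card (A - C) \<le> k \<and> card (A - C) \<le> card A \<and> card (A \<inter> C) = card A - card (A - C)"
        using A assms by auto
    qed
    show "finite ?P"
      using fin assms by (intro finite_SigmaI) auto
  qed
  also have "card ?P = (\<Sum>J\<in>{T \<in> ?Q. card T \<le> s \<and> card T < t}. card C choose (s - card J))"
    using fin assms by (subst card_SigmaI) (auto simp: n_subsets)
  also have "\<dots> \<le> (\<Sum>J\<in>{T \<in> ?Q. card T \<le> s \<and> card T < t}. (R + t) choose s)"
  proof (rule sum_mono)
    fix J assume J: "J \<in> {T \<in> ?Q. card T \<le> s \<and> card T < t}"
    have "card C choose (s - card J) \<le> (card C + card J) choose s"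
      using J by (intro binomial_diff_le) auto
    also have "\<dots> \<le> (R + t) choose s"
      using J assms by (intro binomial_right_mono) auto
    finally show "card C choose (s - card J) \<le> (R + t) choose s" .
  qed
  also have "\<dots> = card {T \<in> ?Q. card T \<le> s \<and> card T < t} * ((R + t) choose s)"
    by simp
  also have "\<dots> \<le> card ?Q * ((R + t) choose s)"
    using assms by (intro mult_right_mono card_mono) auto
  finally show ?thesis .
qed

section \<open>Binomial coefficients under rescaling of the upper argument\<close>

lemma sum_inverse_sqrt_le: "(\<Sum>j=1..s. 1 / sqrt (real j)) \<le> 2 * sqrt (real s)"
proof (induction s)
  case (Suc s)
  let ?a = "sqrt (real s)" and ?b = "sqrt (real (Suc s))"
  have b: "0 < ?b" and ab: "?a \<le> ?b" and sq: "?b * ?b - ?a * ?a = 1"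
    by auto
  have "(?b - ?a) * (?b - ?a) \<ge> 0"
    by simp
  \<comment> \<open>As b^2 - a^2 = 1, the right side equals 1 + (b - a)^2.\<close>
  then have "1 \<le> 2 * (?b - ?a) * ?b"
    using sq by (simp add: algebra_simps)
  then have "1 / ?b \<le> 2 * (?b - ?a)"
    using b by (simp add: field_simps)
  then show ?case
    using Suc by simp
qed simp

lemma gchoose_mono_real:
  fixes x y :: real
  assumes "real s \<le> x" "x \<le> y"
  shows "x gchoose s \<le> y gchoose s"
  unfolding gbinomial_prod_rev using assms
  by (intro divide_right_mono prod_mono) auto

lemma gchoose_ge_1:
  fixes x :: real
  assumes "real s \<le> x"
  shows "1 \<le> x gchoose s"
  using gchoose_mono_real[of s "real s" x] assms by (simp flip: binomial_gbinomial)

text \<open>Since x is at least s, the i-th factor grows by at most 1 + y with y = \<epsilon> s / (s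
  - i). Using exp (2 sqrt y) instead of exp y matters: the values y form a harmonic sum, which would
  cost an extra log s, while their square roots sum to at most 2 sqrt \<epsilon> s.\<close>

lemma gchoose_scale_le:
  fixes x \<epsilon> :: real
  assumes x: "real s \<le> x" and \<epsilon>: "0 \<le> \<epsilon>"
  shows "((1 + \<epsilon>) * x) gchoose s \<le> exp (4 * sqrt \<epsilon> * real s) * (x gchoose s)"
proof -
  have "(\<Prod>i=0..<s. (1 + \<epsilon>) * x - real i) \<le> (\<Prod>i=0..<s. exp (2 * sqrt (\<epsilon> * real s / real (s - i))) * (x - real i))"
  proof (intro prod_mono conjI)
    fix i assume "i \<in> {0..<s}"
    then have i: "i < s" by simp
    have "0 \<le> \<epsilon> * x"
      using x \<epsilon> by simp
    then show "0 \<le> (1 + \<epsilon>) * x - real i"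
      using x i by (simp add: algebra_simps)
    define y where "y = \<epsilon> * real s / real (s - i)"
    have y: "0 \<le> y"
      using \<epsilon> by (simp add: y_def)
    have "x * real (s - i) \<le> real s * (x - real i)"
      using i mult_right_mono[OF x, of "real i"] by (simp add: of_nat_diff algebra_simps)
    then have "x \<le> real s / real (s - i) * (x - real i)"
      using i by (simp add: field_simps)
    then have "\<epsilon> * x \<le> \<epsilon> * (real s / real (s - i) * (x - real i))"
      using \<epsilon> by (intro mult_left_mono)
    then have "(1 + \<epsilon>) * x - real i \<le> (1 + y) * (x - real i)"
      by (simp add: y_def algebra_simps)
    also have "1 + y \<le> (1 + sqrt y) * (1 + sqrt y)"
      using y by (simp add: algebra_simps)
    also have "\<dots> \<le> exp (sqrt y) * exp (sqrt y)"
      using y by (intro mult_mono exp_ge_add_one_self) auto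
    also have "\<dots> = exp (2 * sqrt y)"
      by (simp flip: exp_add)
    finally show "(1 + \<epsilon>) * x - real i \<le> exp (2 * sqrt (\<epsilon> * real s / real (s - i))) * (x - real i)"
      using x i by (simp add: y_def mult_right_mono)
  qed
  also have "\<dots> = exp (\<Sum>i=0..<s. 2 * sqrt (\<epsilon> * real s / real (s - i))) * (\<Prod>i=0..<s. x - real i)"
    by (simp add: prod.distrib exp_sum)
  also have "(\<Sum>i=0..<s. 2 * sqrt (\<epsilon> * real s / real (s - i)))
      = 2 * sqrt (\<epsilon> * real s) * (\<Sum>i=0..<s. 1 / sqrt (real (s - i)))"
    by (simp add: sum_distrib_left real_sqrt_divide)
  also have "(\<Sum>i=0..<s. 1 / sqrt (real (s - i))) = (\<Sum>j=1..s. 1 / sqrt (real j))"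
    by (rule sum.reindex_bij_witness[of _ "\<lambda>j. s - j" "\<lambda>i. s - i"]) auto
  also have "exp (2 * sqrt (\<epsilon> * real s) * (\<Sum>j=1..s. 1 / sqrt (real j))) * (\<Prod>i=0..<s. x - real i)
      \<le> exp (4 * sqrt \<epsilon> * real s) * (\<Prod>i=0..<s. x - real i)"
  proof -
    have "2 * sqrt (\<epsilon> * real s) * (\<Sum>j=1..s. 1 / sqrt (real j)) \<le> 2 * sqrt (\<epsilon> * real s) * (2 * sqrt (real s))"
      using \<epsilon> by (intro mult_left_mono sum_inverse_sqrt_le) auto
    also have "\<dots> = 4 * sqrt \<epsilon> * real s"
      by (simp add: real_sqrt_mult)
    finally show ?thesis
      using x by (intro mult_right_mono prod_nonneg) auto
  qed
  finally show ?thesis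
    unfolding gbinomial_prod_rev by (simp add: divide_right_mono)
qed

section \<open>The count for fixed parameters\<close>

lemma finite_subgroup_cards:
  "finite {card H | H. subgroup H G \<and> finite H \<and> real (card H) \<le> x}"
proof (rule finite_subset)
  show "{card H | H. subgroup H G \<and> finite H \<and> real (card H) \<le> x} \<subseteq> {..nat \<lfloor>x\<rfloor>}"
    by (auto simp: le_nat_floor)
qed simp

lemma card_le_subgroup_beta:
  assumes "subgroup H G" "finite H" "real (card H) \<le> x"
  shows "card H \<le> subgroup_beta G x"
  unfolding subgroup_beta_def using assms by (intro Max_ge finite_subgroup_cards) auto

text \<open>Union bound over the containers. The \<open>2 * Suc j\<close> fingerprints and the set
  \<open>A - C\<close> make q = 2 j + 3 sets of at most k elements, costing n^((k + 1) q), which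
  \<open>sparse\<close> bounds by 2^(\<gamma> s). Rescaling the binomial by 1 + 2 \<gamma> costs the
  rest of the exponent.\<close>

lemma count_small_doubling:
  fixes m s n :: nat and \<gamma> :: real
  assumes G: "comm_group G" and Y: "Y \<subseteq> carrier G" "card Y = n" and n: "2 \<le> n"
    and ms: "2 * s \<le> m" "0 < m" and \<gamma>: "0 < \<gamma>" "\<gamma> \<le> 1"
    and \<kappa>: "\<kappa> = \<gamma>\<^sup>2 / 68" and j: "3 < real j * (2 * \<kappa>)"
    and sparse: "sqrt (real m) * log 2 (real n) \<le> \<gamma> * \<kappa> / (3 * (2 * real j + 3)) * real s"
  shows "real (card {A. A \<subseteq> Y \<and> card A = s \<and> card (A <#>\<^bsub>G\<^esub> A) \<le> m})
    \<le> 2 powr ((\<gamma> + 8 * sqrt (2 * \<gamma>)) * real s) *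
       trunc_binomial ((real m + real (subgroup_beta G ((1 + \<gamma>) * real m))) / 2) s"
proof -
  interpret comm_group G by (rule G)
  define \<beta> where "\<beta> = subgroup_beta G ((1 + \<gamma>) * real m)"
  define x where "x = (real m + real \<beta>) / 2"
  define q where "q = 2 * j + 3"
  define \<theta> where "\<theta> = \<gamma> * \<kappa> / (3 * real q)"
  \<comment> \<open>With these choices \<open>t\<close> and \<open>k\<close> are both of order sqrt
    m for fixed \<kappa>, yet \<kappa> t k reaches m.\<close>
  define t where "t = nat \<lceil>sqrt (real m)\<rceil>"
  define k where "k = nat \<lceil>sqrt (real m) / \<kappa>\<rceil>"
  define R where "R = nat \<lfloor>(1 + \<gamma>) * x\<rfloor>"
  define N where "N = card {T. T \<subseteq> Y \<and> card T \<le> k}"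
  define F where "F = {A. A \<subseteq> Y \<and> card A = s \<and> card (A <#>\<^bsub>G\<^esub> A) \<le> m}"
  \<comment> \<open>Infinite sets have \<open>card\<close> 0, so a positive \<open>n\<close> forces
    finiteness.\<close>
  have finY: "finite Y"
    using Y n card.infinite by fastforce
  have \<kappa>': "0 < \<kappa>" "\<kappa> \<le> 1 / 68"
    using \<gamma> power_le_one[of \<gamma> 2] by (auto simp: \<kappa>)
  have m1: "1 \<le> sqrt (real m)"
    using ms by simp
  have L: "1 \<le> log 2 (real n)"
    using n by simp
  have q: "3 \<le> real q"
    by (simp add: q_def)
  have \<theta>: "0 < \<theta>" "\<theta> \<le> \<gamma> / 600"
  proof -
    show "0 < \<theta>"
      using \<gamma> \<kappa>' q by (simp add: \<theta>_def)
    have "\<gamma> * \<kappa> / (3 * real q) \<le> \<gamma> * (1 / 68) / 9"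
      using \<gamma> \<kappa>' q by (intro frac_le mult_left_mono) auto
    then show "\<theta> \<le> \<gamma> / 600"
      using \<gamma> by (simp add: \<theta>_def)
  qed
  have sp: "sqrt (real m) * log 2 (real n) \<le> \<theta> * real s"
    using sparse by (simp add: \<theta>_def q_def algebra_simps)
  have sm: "sqrt (real m) \<le> \<theta> * real s"
    using sp L m1 mult_left_mono[of 1 "log 2 (real n)" "sqrt (real m)"] by linarith
  have sm': "sqrt (real m) \<le> \<gamma> / 600 * real s"
    using sm \<theta> mult_right_mono[of \<theta> "\<gamma> / 600" "real s"] by linarith
  have big_m: "4 * sqrt (real m) \<le> \<gamma> * real m"
  proof -
    have "\<gamma> / 600 * real s \<le> \<gamma> / 600 * (real m / 2)"
      using ms \<gamma> by (intro mult_left_mono) auto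
    moreover have "0 \<le> \<gamma> * real m"
      using \<gamma> by simp
    ultimately show ?thesis
      using sm' by (simp add: field_simps)
  qed
  have m4: "4 \<le> \<gamma> * real m"
    using big_m m1 by linarith
  have t: "sqrt (real m) \<le> real t" "real t \<le> 2 * sqrt (real m)" "0 < t"
    using m1 unfolding t_def by linarith+
  have k1: "sqrt (real m) / \<kappa> \<le> real k" "real k \<le> sqrt (real m) / \<kappa> + 1"
    using m1 \<kappa>' unfolding k_def by (simp_all add: le_nat_iff of_nat_nat)
  have tk: "t \<le> k"
  proof -
    have "sqrt (real m) * \<kappa> \<le> sqrt (real m) * 1"
      using m1 \<kappa>' by (intro mult_left_mono) auto
    then have "sqrt (real m) \<le> sqrt (real m) / \<kappa>"
      using \<kappa>' by (simp add: field_simps)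
    then show ?thesis
      unfolding t_def k_def by (intro nat_mono ceiling_mono)
  qed
  have mk: "real m \<le> \<kappa> * real t * real k"
  proof -
    have "sqrt (real m) * sqrt (real m) \<le> real t * (\<kappa> * real k)"
      using t k1 m1 \<kappa>' by (intro mult_mono) (auto simp: field_simps)
    then show ?thesis
      by (simp add: mult_ac)
  qed
  \<comment> \<open>Containers are only guaranteed for sets with at least \<open>t\<close>
    elements.\<close>
  have ts: "t \<le> s"
  proof -
    have "\<gamma> / 600 * real s \<le> 1 / 600 * real s"
      using \<gamma> by (intro mult_right_mono) auto
    then show ?thesis
      using t sm' by linarith
  qed
  have beta: "card H \<le> \<beta>" if "subgroup H G" "finite H" "real (card H) \<le> (1 + \<gamma>) * real m" for H
    using that card_le_subgroup_beta by (simp add: \<beta>_def)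
  obtain \<C> where \<C>: "finite \<C>" "card \<C> \<le> N ^ (2 * Suc j)"
    "\<And>C. C \<in> \<C> \<Longrightarrow> finite C \<and> real (card C) \<le> (1 + \<gamma>) * x"
    "\<And>A. A \<subseteq> Y \<Longrightarrow> t \<le> card A \<Longrightarrow> card (A <#>\<^bsub>G\<^esub> A) \<le> m \<Longrightarrow> \<exists>C\<in>\<C>. card (A - C) < t"
    unfolding N_def x_def
    by (rule small_doubling_containers[OF Y(1) finY \<gamma> m4 \<kappa> j t(3) tk mk beta]) auto
  have x: "real s \<le> x"
    using ms by (simp add: x_def)
  have "F \<subseteq> (\<Union>C\<in>\<C>. {A. A \<subseteq> Y \<and> card A = s \<and> card (A - C) < t})"
    using \<C>(4) ts by (fastforce simp: F_def)
  then have "card F \<le> card (\<Union>C\<in>\<C>. {A. A \<subseteq> Y \<and> card A = s \<and> card (A - C) < t})"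
    using \<C>(1) finY by (intro card_mono) auto
  also have "\<dots> \<le> (\<Sum>C\<in>\<C>. card {A. A \<subseteq> Y \<and> card A = s \<and> card (A - C) < t})"
    using \<C>(1) by (rule card_UN_le)
  also have "\<dots> \<le> (\<Sum>C\<in>\<C>. N * ((R + t) choose s))"
    unfolding N_def using \<C>(3) finY tk
    by (intro sum_mono card_almost_subsets_le) (auto simp: R_def le_nat_floor)
  also have "\<dots> = card \<C> * (N * ((R + t) choose s))"
    by simp
  also have "\<dots> \<le> N ^ (2 * Suc j) * (N * ((R + t) choose s))"
    using \<C>(2) by (intro mult_right_mono) auto
  also have "\<dots> = N ^ q * ((R + t) choose s)"
    by (simp add: q_def eval_nat_numeral)
  also have "\<dots> \<le> (n ^ Suc k) ^ q * ((R + t) choose s)"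
    using card_subsets_bounded_le[OF finY, of k] Y n by (intro mult_right_mono power_mono) (auto simp: N_def)
  finally have 1: "real (card F) \<le> real ((n ^ Suc k) ^ q) * real ((R + t) choose s)"
    by (metis of_nat_le_iff of_nat_mult)
  have 2: "real ((n ^ Suc k) ^ q) \<le> 2 powr (\<gamma> * real s)"
  proof -
    have "real ((n ^ Suc k) ^ q) = real n ^ (Suc k * q)"
      by (simp only: of_nat_power power_mult)
    also have "\<dots> = real n powr (real (Suc k) * real q)"
      using n by (subst powr_realpow[symmetric]) (auto simp only: of_nat_mult)
    also have "\<dots> = (2 powr log 2 (real n)) powr (real (Suc k) * real q)"
      using n by simp
    also have "\<dots> = 2 powr (log 2 (real n) * (real (Suc k) * real q))"
      by (rule powr_powr)
    also have "log 2 (real n) * (real (Suc k) * real q) \<le> \<gamma> * real s"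
    proof -
      have "\<kappa> \<le> sqrt (real m)"
        using \<kappa>' m1 by linarith
      then have "2 \<le> 2 * (sqrt (real m) / \<kappa>)"
        using \<kappa>'(1) by (simp add: field_simps)
      \<comment> \<open>The factor 3 absorbs the rounding in \<open>k\<close> and the successor; it
        is the 3 in \<open>sparse\<close>.\<close>
      then have "real (Suc k) \<le> 3 * (sqrt (real m) / \<kappa>)"
        using k1 by simp
      then have "log 2 (real n) * (real (Suc k) * real q) \<le> log 2 (real n) * (3 * (sqrt (real m) / \<kappa>) * real q)"
        using L by (intro mult_left_mono mult_right_mono) auto
      also have "\<dots> = sqrt (real m) * log 2 (real n) * (3 * real q / \<kappa>)"
        by simp
      also have "\<dots> \<le> \<theta> * real s * (3 * real q / \<kappa>)"
        using sp q \<kappa>' by (intro mult_right_mono) auto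
      also have "\<dots> = \<gamma> * real s"
        using q \<kappa>' by (simp add: \<theta>_def)
      finally show ?thesis .
    qed
    finally show ?thesis by simp
  qed
  have 3: "real ((R + t) choose s) \<le> 2 powr (8 * sqrt (2 * \<gamma>) * real s) * (x gchoose s)"
  proof -
    have x0: "0 \<le> x"
      using x by linarith
    have "real t \<le> \<gamma> * x"
    proof -
      have "\<gamma> * real m / 2 \<le> \<gamma> * x"
        using \<gamma> by (simp add: x_def field_simps)
      then show ?thesis
        using t big_m by linarith
    qed
    moreover have "real R \<le> (1 + \<gamma>) * x"
      using x0 \<gamma> by (simp add: R_def)
    ultimately have Rt: "real (R + t) \<le> (1 + 2 * \<gamma>) * x"
      by (simp add: algebra_simps)
    have "real ((R + t) choose s) \<le> ((1 + 2 * \<gamma>) * x) gchoose s"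
    proof (cases "s \<le> R + t")
      case True
      then show ?thesis
        using gchoose_mono_real[of s "real (R + t)"] Rt by (simp add: binomial_gbinomial)
    next
      \<comment> \<open>Monotonicity needs an upper argument of at least \<open>s\<close>; below
        that the left side is 0.\<close>
      case False
      have "x \<le> (1 + 2 * \<gamma>) * x"
        using x0 \<gamma> by (simp add: algebra_simps)
      then have "1 \<le> ((1 + 2 * \<gamma>) * x) gchoose s"
        using x by (intro gchoose_ge_1) linarith
      then show ?thesis
        using False by (simp add: binomial_eq_0)
    qed
    also have "\<dots> \<le> exp (4 * sqrt (2 * \<gamma>) * real s) * (x gchoose s)"
      using x \<gamma> by (intro gchoose_scale_le) auto
    also have "\<dots> \<le> 2 powr (8 * sqrt (2 * \<gamma>) * real s) * (x gchoose s)"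
    proof (rule mult_right_mono)
      \<comment> \<open>Passing from base e to base 2 turns the constant 4 into 8.\<close>
      have "1 / 2 \<le> ln (2 :: real)"
        using ln_le_minus_one[of "1 / 2 :: real"] by (simp add: ln_div)
      then have "8 * sqrt (2 * \<gamma>) * real s * (1 / 2) \<le> 8 * sqrt (2 * \<gamma>) * real s * ln 2"
        using \<gamma> by (intro mult_left_mono) auto
      then show "exp (4 * sqrt (2 * \<gamma>) * real s) \<le> 2 powr (8 * sqrt (2 * \<gamma>) * real s)"
        by (simp add: powr_def)
      show "0 \<le> x gchoose s"
        using gchoose_ge_1[OF x] by linarith
    qed
    finally show ?thesis .
  qed
  have "real (card F) \<le> 2 powr (\<gamma> * real s) * (2 powr (8 * sqrt (2 * \<gamma>) * real s) * (x gchoose s))"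
    using 1 2 3 by (meson mult_mono of_nat_0_le_iff order_trans powr_ge_zero)
  also have "\<dots> = 2 powr ((\<gamma> + 8 * sqrt (2 * \<gamma>)) * real s) * (x gchoose s)"
    by (simp add: powr_add ring_distribs mult.assoc)
  finally show ?thesis
    using x by (simp add: F_def trunc_binomial_def x_def \<beta>_def)
qed

section \<open>Letting the error parameters tend to zero\<close>

lemma diagonal_index:
  assumes P: "\<And>k. eventually (P k) sequentially"
  obtains f :: "nat \<Rightarrow> nat" where "filterlim f at_top sequentially"
    "eventually (\<lambda>n. P (f n) n) sequentially"
proof -
  \<comment> \<open>The index is \<open>Max (K n)\<close>: every fixed \<open>k\<close> eventually
    belongs to \<open>K n\<close>, so it tends to infinity, and being attained it satisfies
    \<open>P\<close> once \<open>K n\<close> is nonempty.\<close>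
  define K where "K n = {k. k \<le> n \<and> P k n}" for n
  have fin: "finite (K n)" for n
    by (simp add: K_def)
  have "filterlim (\<lambda>n. Max (K n)) at_top sequentially"
    unfolding filterlim_at_top
  proof
    fix k
    show "eventually (\<lambda>n. k \<le> Max (K n)) sequentially"
      using P[of k] eventually_ge_at_top[of k]
      by eventually_elim (rule Max_ge[OF fin], simp add: K_def)
  qed
  moreover have "eventually (\<lambda>n. P (Max (K n)) n) sequentially"
    using P[of 0]
  proof eventually_elim
    case (elim n)
    then have "K n \<noteq> {}"
      by (auto simp: K_def)
    then show ?case
      using Max_in[OF fin, of n] by (simp add: K_def)
  qed
  ultimately show ?thesis
    using that by blast
qed

theorem theorem1p2:
  fixes G :: "nat \<Rightarrow> ('a, 'b) monoid_scheme"
    and Y :: "nat \<Rightarrow> 'a set"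
    and m s :: "nat \<Rightarrow> nat"
  assumes "\<And>n. n \<ge> 1 \<Longrightarrow> comm_group (G n)"
    and "\<And>n. n \<ge> 1 \<Longrightarrow> Y n \<subseteq> carrier (G n)"
    and "\<And>n. n \<ge> 1 \<Longrightarrow> card (Y n) = n"
    and "\<And>n. n \<ge> 1 \<Longrightarrow> m n > 0"
    and "\<And>n. n \<ge> 1 \<Longrightarrow> s n > 0"
    and "\<And>n. n \<ge> 1 \<Longrightarrow> 2 * s n \<le> m n"
    and "(\<lambda>n. real (m n)) \<in> o(\<lambda>n. (real (s n))\<^sup>2 / (log 2 (real n))\<^sup>2)"
  shows "\<exists>\<epsilon> \<eta> :: nat \<Rightarrow> real. \<epsilon> \<longlonglongrightarrow> 0 \<and> \<eta> \<longlonglongrightarrow> 0 \<and>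
    (\<forall>n\<ge>1. real (card {A. A \<subseteq> Y n \<and> card A = s n \<and> card (A <#>\<^bsub>G n\<^esub> A) \<le> m n})
      \<le> 2 powr (\<epsilon> n * real (s n)) *
         trunc_binomial
           ((real (m n) + real (subgroup_beta (G n) ((1 + \<eta> n) * real (m n)))) / 2) (s n))"
proof -
  define bound where "bound \<epsilon> \<eta> n \<longleftrightarrow>
    real (card {A. A \<subseteq> Y n \<and> card A = s n \<and> card (A <#>\<^bsub>G n\<^esub> A) \<le> m n})
      \<le> 2 powr (\<epsilon> * real (s n)) *
         trunc_binomial ((real (m n) + real (subgroup_beta (G n) ((1 + \<eta>) * real (m n)))) / 2) (s n)"
    for \<epsilon> \<eta> :: real and n
  define \<gamma> :: "nat \<Rightarrow> real" where "\<gamma> k = 1 / real (Suc k)" for k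
  define h :: "real \<Rightarrow> real" where "h g = g + 8 * sqrt (2 * g)" for g
  have "eventually (\<lambda>n. bound (h (\<gamma> k)) (\<gamma> k) n) sequentially" for k
  proof -
    define g where "g = \<gamma> k"
    have g: "0 < g" "g \<le> 1"
      by (auto simp: g_def \<gamma>_def)
    define \<kappa> where "\<kappa> = g\<^sup>2 / 68"
    have \<kappa>: "0 < \<kappa>"
      using g by (simp add: \<kappa>_def)
    obtain j :: nat where "3 / (2 * \<kappa>) < real j"
      using reals_Archimedean2 by blast
    then have j: "3 < real j * (2 * \<kappa>)"
      using \<kappa> by (simp add: field_simps)
    define \<theta> where "\<theta> = g * \<kappa> / (3 * (2 * real j + 3))"
    have \<theta>: "0 < \<theta>"
      using g \<kappa> by (auto simp: \<theta>_def intro!: divide_pos_pos)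
    \<comment> \<open>The little-o hypothesis with constant \<theta> squared; taking roots gives the
      sparsity condition of \<open>count_small_doubling\<close>.\<close>
    have "eventually (\<lambda>n. norm (real (m n)) \<le> \<theta>\<^sup>2 * norm ((real (s n))\<^sup>2 / (log 2 (real n))\<^sup>2)) sequentially"
      using \<theta> by (intro landau_o.smallD[OF assms(7)]) simp
    then have "eventually (\<lambda>n. bound (h g) g n) sequentially"
      using eventually_ge_at_top[of 2]
    proof eventually_elim
      case (elim n)
      have L: "1 \<le> log 2 (real n)"
        using elim by simp
      have "real (m n) \<le> (\<theta> * real (s n) / log 2 (real n))\<^sup>2"
        using elim by (simp add: power_mult_distrib power_divide)
      then have "sqrt (real (m n)) \<le> \<theta> * real (s n) / log 2 (real n)"
        using \<theta> L by (intro real_le_lsqrt) auto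
      then have "sqrt (real (m n)) * log 2 (real n) \<le> \<theta> * real (s n)"
        using L by (simp add: field_simps)
      then show ?case
        unfolding bound_def h_def using elim assms g j
        by (intro count_small_doubling[where \<kappa> = \<kappa> and j = j and n = n]) (auto simp: \<kappa>_def \<theta>_def)
    qed
    then show ?thesis
      by (simp add: g_def)
  qed
  then obtain f where f: "filterlim f at_top sequentially"
    and good: "eventually (\<lambda>n. bound (h (\<gamma> (f n))) (\<gamma> (f n)) n) sequentially"
    using diagonal_index[of "\<lambda>k n. bound (h (\<gamma> k)) (\<gamma> k) n"] by blast
  define \<eta> where "\<eta> n = \<gamma> (f n)" for n
  \<comment> \<open>The bound fails for finitely many \<open>n\<close> only, so the value there
    leaves the limit alone; with exponent \<open>n\<close> the trivial count 2^n suffices, as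
    \<open>s n\<close> and the binomial factor are at least 1.\<close>
  define \<epsilon> where "\<epsilon> n = (if bound (h (\<eta> n)) (\<eta> n) n then h (\<eta> n) else real n)" for n
  have "\<gamma> \<longlonglongrightarrow> 0"
    unfolding \<gamma>_def using LIMSEQ_inverse_real_of_nat by (simp add: inverse_eq_divide)
  then have \<eta>: "\<eta> \<longlonglongrightarrow> 0"
    unfolding \<eta>_def using f by (rule filterlim_compose)
  have "(\<lambda>n. h (\<eta> n)) \<longlonglongrightarrow> 0 + 8 * sqrt (2 * 0)"
    unfolding h_def by (intro tendsto_intros \<eta>)
  moreover have "eventually (\<lambda>n. h (\<eta> n) = \<epsilon> n) sequentially"
    using good by eventually_elim (simp add: \<epsilon>_def \<eta>_def)
  ultimately have \<epsilon>: "\<epsilon> \<longlonglongrightarrow> 0"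
    by (simp add: tendsto_cong)
  have "bound (\<epsilon> n) (\<eta> n) n" if n: "1 \<le> n" for n
  proof (cases "bound (h (\<eta> n)) (\<eta> n) n")
    case True
    then show ?thesis
      by (simp add: \<epsilon>_def)
  next
    case False
    let ?x = "(real (m n) + real (subgroup_beta (G n) ((1 + \<eta> n) * real (m n)))) / 2"
    have finY: "finite (Y n)"
      using assms(3)[OF n] n card.infinite by fastforce
    have "card {A. A \<subseteq> Y n \<and> card A = s n \<and> card (A <#>\<^bsub>G n\<^esub> A) \<le> m n} \<le> card (Pow (Y n))"
      using finY by (intro card_mono) auto
    then have "real (card {A. A \<subseteq> Y n \<and> card A = s n \<and> card (A <#>\<^bsub>G n\<^esub> A) \<le> m n}) \<le> 2 ^ n"
      using finY assms(3)[OF n] by (simp add: card_Pow)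
    also have "\<dots> = 2 powr real n"
      by (simp add: powr_realpow)
    also have "\<dots> \<le> 2 powr (real n * real (s n))"
      using assms(5)[OF n] by (intro powr_mono) (auto simp: mult_le_cancel_left1)
    also have "\<dots> \<le> 2 powr (real n * real (s n)) * trunc_binomial ?x (s n)"
    proof -
      have "real (s n) \<le> ?x"
        using assms(6)[OF n] by simp
      then show ?thesis
        using gchoose_ge_1[of "s n" ?x] by (simp add: trunc_binomial_def)
    qed
    finally show ?thesis
      using False by (simp add: bound_def \<epsilon>_def)
  qed
  then show ?thesis
    using \<epsilon> \<eta> unfolding bound_def by blast
qed

end
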